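(* Let $G,K,P=MN,V$ be as in the context, and let $j$, $I_0$ and $\mathcal S'$ be the maps defined there. (i) The map $\mathcal S':\mathrm{End}_G(\text{c-Ind}_K^GV)\to\mathrm{End}_M(\text{c-Ind}_{K\cap M}^MV_{N\cap K})$ is an algebra homomorphism such that $I_0\circ b=(\mathrm{Ind}_P^G\mathcal S'(b))\circ I_0$ for all $b\in\mathrm{End}_G(\text{c-Ind}_K^GV)$. (ii) For every smooth $C[M]$-module $W$ and every $\alpha\in\mathrm{Hom}_M(\text{c-Ind}_{K\cap M}^MV_{N\cap K},W)$, one has $j((\mathrm{Ind}_P^G\alpha)\circ I_0)=\alpha$. (iii) For every smooth $C[M]$-module $W$, every $b\in\mathrm{End}_G(\text{c-Ind}_K^GV)$ and every $I\in\mathrm{Hom}_G(\text{c-Ind}_K^GV,\mathrm{Ind}_P^GW)$, one has $j(I\circ b)=j(I)\circ\mathcal S'(b)$.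
   Context: $C$ is any field, $G$ is a locally profinite group, $K$ an open subgroup of $G$, $P$ a closed subgroup of $G$ with $G=KP$ (Iwasawa decomposition). $P$ is the semi-direct product of a closed normal subgroup $N$ and a closed subgroup $M$, and $P\cap K$ is the semi-direct product of $N\cap K$ by $M\cap K$. Each double coset $KgK$ is the union of finitely many cosets $Kg'$ and of finitely many cosets $g''K$. $V$ is a smooth $C[K]$-module, finite dimensional over $C$. $V_{N\cap K}$ is the space of $N\cap K$-coinvariants of $V$, a smooth $C[M\cap K]$-module; $\overline v$ is the image of $v\in V$. $\text{c-Ind}_K^GV$ is the space of functions $f:G\to V$ with $f(xg)=xf(g)$ for $x\in K$ and support a finite union of cosets $Kg$, $G$ acting by right translation; $[1,v]_K$ is the function with support $K$ and value $v$ at $1$. Similarly for $\text{c-Ind}_{K\cap M}^M$ and $[1,\overline v]_{M\cap K}$. For a smooth $C[M]$-module $W$, inflated to $P$, $\mathrm{Ind}_P^GW$ is the full smooth induced representation (functions $f(pg)=pf(g)$, smooth under right translation), and for a homomorphism $\alpha$ of $C[M]$-modules $\mathrm{Ind}_P^G\alpha$ is $f\mapsto\alpha\circ f$. For any smooth $C[M]$-module $W$, $$j:\mathrm{Hom}_G(\text{c-Ind}_K^GV,\mathrm{Ind}_P^GW)\to\mathrm{Hom}_M(\text{c-Ind}_{K\cap M}^MV_{N\cap K},W)$$ is the isomorphism (obtained by Frobenius reciprocities) sending $I$ to the $C[M]$-linear map $[1,\overline v]_{M\cap K}\mapsto(I[1,v]_K)(1)$. For $W=\text{c-Ind}_{K\cap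 M}^MV_{N\cap K}$ this isomorphism is denoted $j_0$; $I_0\in\mathrm{Hom}_G(\text{c-Ind}_K^GV,\mathrm{Ind}_P^G(\text{c-Ind}_{K\cap M}^MV_{N\cap K}))$ is the element with $j_0(I_0)=\mathrm{id}$, and $\mathcal S'(b):=j_0(I_0\circ b)$ for $b\in\mathrm{End}_G(\text{c-Ind}_K^GV)$. *)

theory Defs
  imports "HOL-Analysis.Analysis" "HOL-Algebra.Module" "HOL-Algebra.AbelCoset"
begin

section \<open>Locally profinite groups\<close>

locale topological_group = group G for G (structure) and T +
  assumes topspace_eq: "topspace T = carrier G"
    and continuous_mult: "continuous_map (prod_topology T T) T (\<lambda>(x, y). x \<otimes> y)"
    and continuous_inv: "continuous_map T T (\<lambda>x. inv x)"

locale locally_profinite_group = topological_group +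
  assumes Hausdorff: "Hausdorff_space T"
    and compact_open_subgroups:
      "\<And>U. openin T U \<Longrightarrow> \<one> \<in> U \<Longrightarrow>
        \<exists>L. subgroup L G \<and> openin T L \<and> compactin T L \<and> L \<subseteq> U"

abbreviation subgrp :: "('g, 'm) monoid_scheme \<Rightarrow> 'g set \<Rightarrow> ('g, 'm) monoid_scheme"
  where "subgrp G L \<equiv> G\<lparr>carrier := L\<rparr>"

definition semidirect ::
    "('g, 'm) monoid_scheme \<Rightarrow> 'g set \<Rightarrow> 'g set \<Rightarrow> 'g set \<Rightarrow> bool"
  where "semidirect G P N M \<longleftrightarrow>
    subgroup P G \<and> N \<lhd> subgrp G P \<and> subgroup M (subgrp G P) \<and>
    N <#>\<^bsub>G\<^esub> M = P \<and> N \<inter> M = {\<one>\<^bsub>G\<^esub>}"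


section \<open>Representations\<close>

text \<open>
  A \<open>C[H]\<close>-module is a \<open>C\<close>-module together with a linear action of \<open>H\<close>. The fields
  \<^const>\<open>mult\<close> and \<^const>\<open>one\<close> inherited from the module record play no role.
\<close>

record ('c, 'v, 'g) rep = "('c, 'v) module" +
  act :: "'g \<Rightarrow> 'v \<Rightarrow> 'v"

locale group_rep = H: group H + V: module C V
  for C :: "('c, 'k) ring_scheme" and H :: "('g, 'm) monoid_scheme" and V :: "('c, 'v, 'g) rep" +
  assumes act_closed: "\<lbrakk>h \<in> carrier H; v \<in> carrier V\<rbrakk> \<Longrightarrow> act V h v \<in> carrier V"
    and act_add: "\<lbrakk>h \<in> carrier H; v \<in> carrier V; w \<in> carrier V\<rbrakk> \<Longrightarrow>
      act V h (v \<oplus>\<^bsub>V\<^esub> w) = act V h v \<oplus>\<^bsub>V\<^esub> act V h w"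
    and act_smult: "\<lbrakk>h \<in> carrier H; c \<in> carrier C; v \<in> carrier V\<rbrakk> \<Longrightarrow>
      act V h (c \<odot>\<^bsub>V\<^esub> v) = c \<odot>\<^bsub>V\<^esub> act V h v"
    and act_one: "v \<in> carrier V \<Longrightarrow> act V \<one>\<^bsub>H\<^esub> v = v"
    and act_mult: "\<lbrakk>g \<in> carrier H; h \<in> carrier H; v \<in> carrier V\<rbrakk> \<Longrightarrow>
      act V (g \<otimes>\<^bsub>H\<^esub> h) v = act V g (act V h v)"

definition smooth_vector ::
    "('g, 'm) monoid_scheme \<Rightarrow> 'g topology \<Rightarrow> ('c, 'v, 'g) rep \<Rightarrow> 'v \<Rightarrow> bool"
  where "smooth_vector H T V v \<longleftrightarrow> openin T {h \<in> carrier H. act V h v = v}"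

locale smooth_rep = group_rep +
  fixes T
  assumes smooth: "v \<in> carrier V \<Longrightarrow> smooth_vector H T V v"

definition finite_dimensional :: "('c, 'k) ring_scheme \<Rightarrow> ('c, 'v, 'g) rep \<Rightarrow> bool"
  where "finite_dimensional C V \<longleftrightarrow>
    (\<exists>B. finite B \<and> B \<subseteq> carrier V \<and> (\<lambda>S. submodule S C V) hull B = carrier V)"

text \<open>Homomorphisms are made extensional, so that they are equal iff they agree on the carrier.\<close>

definition rep_hom ::
    "('c, 'k) ring_scheme \<Rightarrow> ('g, 'm) monoid_scheme \<Rightarrow>
      ('c, 'v, 'g) rep \<Rightarrow> ('c, 'w, 'g) rep \<Rightarrow> ('v \<Rightarrow> 'w) set"
  where "rep_hom C H V W = {f \<in> carrier V \<rightarrow>\<^sub>E carrier W.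
    (\<forall>v\<in>carrier V. \<forall>v'\<in>carrier V. f (v \<oplus>\<^bsub>V\<^esub> v') = f v \<oplus>\<^bsub>W\<^esub> f v') \<and>
    (\<forall>c\<in>carrier C. \<forall>v\<in>carrier V. f (c \<odot>\<^bsub>V\<^esub> v) = c \<odot>\<^bsub>W\<^esub> f v) \<and>
    (\<forall>h\<in>carrier H. \<forall>v\<in>carrier V. f (act V h v) = act W h (f v))}"

definition End_alg ::
    "('c, 'k) ring_scheme \<Rightarrow> ('g, 'm) monoid_scheme \<Rightarrow>
      ('c, 'v, 'g) rep \<Rightarrow> ('c, 'v \<Rightarrow> 'v) module"
  where "End_alg C H V = \<lparr>
    carrier = rep_hom C H V V,
    mult = (\<lambda>f f'. compose (carrier V) f f'),
    one = (\<lambda>v\<in>carrier V. v),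
    zero = (\<lambda>v\<in>carrier V. \<zero>\<^bsub>V\<^esub>),
    add = (\<lambda>f f'. \<lambda>v\<in>carrier V. f v \<oplus>\<^bsub>V\<^esub> f' v),
    smult = (\<lambda>c f. \<lambda>v\<in>carrier V. c \<odot>\<^bsub>V\<^esub> f v)\<rparr>"

text \<open>The library's \<^locale>\<open>algebra\<close> is commutative; endomorphism algebras are not.\<close>

locale assoc_algebra = module C A + A: ring A for C and A (structure) +
  assumes smult_mult_left: "\<lbrakk>c \<in> carrier C; x \<in> carrier A; y \<in> carrier A\<rbrakk> \<Longrightarrow>
      (c \<odot> x) \<otimes> y = c \<odot> (x \<otimes> y)"
    and smult_mult_right: "\<lbrakk>c \<in> carrier C; x \<in> carrier A; y \<in> carrier A\<rbrakk> \<Longrightarrow>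
      x \<otimes> (c \<odot> y) = c \<odot> (x \<otimes> y)"

locale algebra_hom = A: assoc_algebra C A + B: assoc_algebra C B for C A B +
  fixes h
  assumes hom: "h \<in> ring_hom A B"
    and hom_smult: "\<lbrakk>c \<in> carrier C; x \<in> carrier A\<rbrakk> \<Longrightarrow> h (c \<odot>\<^bsub>A\<^esub> x) = c \<odot>\<^bsub>B\<^esub> h x"


section \<open>Induction, inflation and coinvariants\<close>

definition fun_rep ::
    "('g, 'm) monoid_scheme \<Rightarrow> ('c, 'v, 'g) rep \<Rightarrow> ('g \<Rightarrow> 'v) set \<Rightarrow> ('c, 'g \<Rightarrow> 'v, 'g) rep"
  where "fun_rep H V S = \<lparr>
    carrier = S,
    mult = undefined,
    one = undefined,
    zero = (\<lambda>g\<in>carrier H. \<zero>\<^bsub>V\<^esub>),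
    add = (\<lambda>f f'. \<lambda>g\<in>carrier H. f g \<oplus>\<^bsub>V\<^esub> f' g),
    smult = (\<lambda>c f. \<lambda>g\<in>carrier H. c \<odot>\<^bsub>V\<^esub> f g),
    act = (\<lambda>x f. \<lambda>g\<in>carrier H. f (g \<otimes>\<^bsub>H\<^esub> x))\<rparr>"

definition equivariant_funs ::
    "('g, 'm) monoid_scheme \<Rightarrow> 'g set \<Rightarrow> ('c, 'v, 'g) rep \<Rightarrow> ('g \<Rightarrow> 'v) set"
  where "equivariant_funs H L V =
    {f \<in> carrier H \<rightarrow>\<^sub>E carrier V. \<forall>x\<in>L. \<forall>g\<in>carrier H. f (x \<otimes>\<^bsub>H\<^esub> g) = act V x (f g)}"

definition cInd ::
    "('g, 'm) monoid_scheme \<Rightarrow> 'g set \<Rightarrow> ('c, 'v, 'g) rep \<Rightarrow> ('c, 'g \<Rightarrow> 'v, 'g) rep"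
  where "cInd H L V = fun_rep H V {f \<in> equivariant_funs H L V.
    \<exists>A. finite A \<and> A \<subseteq> carrier H \<and>
      {g \<in> carrier H. f g \<noteq> \<zero>\<^bsub>V\<^esub>} = (\<Union>a\<in>A. L #>\<^bsub>H\<^esub> a)}"

definition cInd_elem ::
    "('g, 'm) monoid_scheme \<Rightarrow> 'g set \<Rightarrow> ('c, 'v, 'g) rep \<Rightarrow> 'v \<Rightarrow> 'g \<Rightarrow> 'v"
  where "cInd_elem H L V v = (\<lambda>g\<in>carrier H. if g \<in> L then act V g v else \<zero>\<^bsub>V\<^esub>)"

definition Ind ::
    "('g, 'm) monoid_scheme \<Rightarrow> 'g topology \<Rightarrow> 'g set \<Rightarrow>
      ('c, 'w, 'g) rep \<Rightarrow> ('c, 'g \<Rightarrow> 'w, 'g) rep"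
  where "Ind H T L W = fun_rep H W
    {f \<in> equivariant_funs H L W. smooth_vector H T (fun_rep H W (equivariant_funs H L W)) f}"

text \<open>Here \<open>(n, m) \<mapsto> n m\<close> is a bijection from \<open>N \<times> M\<close> onto \<open>P\<close>.\<close>

definition Levi_part :: "('g, 'm) monoid_scheme \<Rightarrow> 'g set \<Rightarrow> 'g set \<Rightarrow> 'g \<Rightarrow> 'g"
  where "Levi_part G N M p = (THE m. m \<in> M \<and> (\<exists>n\<in>N. p = n \<otimes>\<^bsub>G\<^esub> m))"

definition inflation ::
    "('g, 'm) monoid_scheme \<Rightarrow> 'g set \<Rightarrow> 'g set \<Rightarrow> ('c, 'w, 'g) rep \<Rightarrow> ('c, 'w, 'g) rep"
  where "inflation G N M W = W\<lparr>act := (\<lambda>p. act W (Levi_part G N M p))\<rparr>"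

definition coinv_kernel ::
    "('c, 'k) ring_scheme \<Rightarrow> 'g set \<Rightarrow> ('c, 'v, 'g) rep \<Rightarrow> 'v set"
  where "coinv_kernel C L V =
    (\<lambda>S. submodule S C V) hull {act V n v \<ominus>\<^bsub>V\<^esub> v | n v. n \<in> L \<and> v \<in> carrier V}"

definition coinv_class ::
    "('c, 'k) ring_scheme \<Rightarrow> 'g set \<Rightarrow> ('c, 'v, 'g) rep \<Rightarrow> 'v \<Rightarrow> 'v set"
  where "coinv_class C L V v = coinv_kernel C L V +>\<^bsub>V\<^esub> v"

text \<open>
  The quotient of \<open>V\<close> by \<^const>\<open>coinv_kernel\<close>. The action is meaningful only for the elements
  that normalise \<open>L\<close>; below it is used with \<open>L = N \<inter> K\<close> and elements of \<open>M \<inter> K\<close>.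
\<close>

definition coinv ::
    "('c, 'k) ring_scheme \<Rightarrow> 'g set \<Rightarrow> ('c, 'v, 'g) rep \<Rightarrow> ('c, 'v set, 'g) rep"
  where "coinv C L V = \<lparr>
    carrier = a_rcosets\<^bsub>V\<^esub> (coinv_kernel C L V),
    mult = undefined,
    one = undefined,
    zero = coinv_kernel C L V,
    add = (\<lambda>X Y. X <+>\<^bsub>V\<^esub> Y),
    smult = (\<lambda>c X. \<Union>v\<in>X. coinv_class C L V (c \<odot>\<^bsub>V\<^esub> v)),
    act = (\<lambda>h X. \<Union>v\<in>X. coinv_class C L V (act V h v))\<rparr>"


section \<open>Parabolic induction and the Satake homomorphism\<close>

locale iwasawa_setting =
  fixes C :: "('c, 'k) ring_scheme" and G :: "('g, 'm) monoid_scheme" and T :: "'g topology"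
    and K P N M :: "'g set" and V :: "('c, 'v, 'g) rep"
  assumes field: "field C"
    and locally_profinite: "locally_profinite_group G T"
    and K_subgroup: "subgroup K G" and K_open: "openin T K"
    and P_subgroup: "subgroup P G" and P_closed: "closedin T P"
    and iwasawa: "carrier G = K <#>\<^bsub>G\<^esub> P"
    and N_closed: "closedin T N" and M_closed: "closedin T M"
    and P_semidirect: "semidirect G P N M"
    and PK_semidirect: "semidirect G (P \<inter> K) (N \<inter> K) (M \<inter> K)"
    and double_coset_right: "\<And>g. g \<in> carrier G \<Longrightarrow>
      \<exists>A. finite A \<and> A \<subseteq> carrier G \<and> K <#>\<^bsub>G\<^esub> (g <#\<^bsub>G\<^esub> K) = (\<Union>a\<in>A. K #>\<^bsub>G\<^esub> a)"
    and double_coset_left: "\<And>g. g \<in> carrier G \<Longrightarrow>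
      \<exists>A. finite A \<and> A \<subseteq> carrier G \<and> K <#>\<^bsub>G\<^esub> (g <#\<^bsub>G\<^esub> K) = (\<Union>a\<in>A. a <#\<^bsub>G\<^esub> K)"
    and V_smooth: "smooth_rep C (subgrp G K) V (subtopology T K)"
    and V_finite_dimensional: "finite_dimensional C V"

text \<open>The representation \<open>c-Ind\<close> of \<open>M\<close> from \<open>M \<inter> K\<close> of the coinvariants of \<open>N \<inter> K\<close> in \<open>V\<close>.\<close>

definition cIndM ::
    "('c, 'k) ring_scheme \<Rightarrow> ('g, 'm) monoid_scheme \<Rightarrow> 'g set \<Rightarrow> 'g set \<Rightarrow> 'g set \<Rightarrow>
      ('c, 'v, 'g) rep \<Rightarrow> ('c, 'g \<Rightarrow> 'v set, 'g) rep"
  where "cIndM C G K N M V = cInd (subgrp G M) (M \<inter> K) (coinv C (N \<inter> K) V)"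

definition IndP ::
    "('g, 'm) monoid_scheme \<Rightarrow> 'g topology \<Rightarrow> 'g set \<Rightarrow> 'g set \<Rightarrow> 'g set \<Rightarrow>
      ('c, 'w, 'g) rep \<Rightarrow> ('c, 'g \<Rightarrow> 'w, 'g) rep"
  where "IndP G T P N M W = Ind G T P (inflation G N M W)"

definition IndP_map ::
    "('g, 'm) monoid_scheme \<Rightarrow> 'g topology \<Rightarrow> 'g set \<Rightarrow> 'g set \<Rightarrow> 'g set \<Rightarrow>
      ('c, 'w, 'g) rep \<Rightarrow> ('w \<Rightarrow> 'w') \<Rightarrow> ('g \<Rightarrow> 'w) \<Rightarrow> 'g \<Rightarrow> 'w'"
  where "IndP_map G T P N M W \<alpha> =
    (\<lambda>f\<in>carrier (IndP G T P N M W). \<lambda>g\<in>carrier G. \<alpha> (f g))"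

text \<open>
  \<open>frob_j\<close> is the Frobenius reciprocity isomorphism \<open>j\<close> for \<open>W\<close>. The functions
  \<open>[1, v]\<^sub>M\<^sub>\<inter>\<^sub>K\<close>, with \<open>v\<close> ranging over the coinvariants, generate \<^const>\<open>cIndM\<close> under \<open>M\<close>, so the
  stated values determine the homomorphism.
\<close>

definition frob_j ::
    "('c, 'k) ring_scheme \<Rightarrow> ('g, 'm) monoid_scheme \<Rightarrow> 'g set \<Rightarrow> 'g set \<Rightarrow> 'g set \<Rightarrow>
      ('c, 'v, 'g) rep \<Rightarrow> ('c, 'w, 'g) rep \<Rightarrow>
      (('g \<Rightarrow> 'v) \<Rightarrow> 'g \<Rightarrow> 'w) \<Rightarrow> ('g \<Rightarrow> 'v set) \<Rightarrow> 'w"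
  where "frob_j C G K N M V W I = (THE \<phi>.
    \<phi> \<in> rep_hom C (subgrp G M) (cIndM C G K N M V) W \<and>
    (\<forall>v\<in>carrier V.
      \<phi> (cInd_elem (subgrp G M) (M \<inter> K) (coinv C (N \<inter> K) V) (coinv_class C (N \<inter> K) V v)) =
      I (cInd_elem G K V v) \<one>\<^bsub>G\<^esub>))"

definition I0 ::
    "('c, 'k) ring_scheme \<Rightarrow> ('g, 'm) monoid_scheme \<Rightarrow> 'g topology \<Rightarrow>
      'g set \<Rightarrow> 'g set \<Rightarrow> 'g set \<Rightarrow> 'g set \<Rightarrow> ('c, 'v, 'g) rep \<Rightarrow>
      ('g \<Rightarrow> 'v) \<Rightarrow> 'g \<Rightarrow> 'g \<Rightarrow> 'v set"
  where "I0 C G T K P N M V = (THE I.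
    I \<in> rep_hom C G (cInd G K V) (IndP G T P N M (cIndM C G K N M V)) \<and>
    frob_j C G K N M V (cIndM C G K N M V) I = (\<lambda>\<phi>\<in>carrier (cIndM C G K N M V). \<phi>))"

definition satake ::
    "('c, 'k) ring_scheme \<Rightarrow> ('g, 'm) monoid_scheme \<Rightarrow> 'g topology \<Rightarrow>
      'g set \<Rightarrow> 'g set \<Rightarrow> 'g set \<Rightarrow> 'g set \<Rightarrow> ('c, 'v, 'g) rep \<Rightarrow>
      (('g \<Rightarrow> 'v) \<Rightarrow> 'g \<Rightarrow> 'v) \<Rightarrow> ('g \<Rightarrow> 'v set) \<Rightarrow> 'g \<Rightarrow> 'v set"
  where "satake C G T K P N M V b =
    frob_j C G K N M V (cIndM C G K N M V)
      (compose (carrier (cInd G K V)) (I0 C G T K P N M V) b)"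

end

(*
  A homomorphism I from c-Ind_K^G V to Ind_P^G W is determined by the map v \<mapsto> I [1, v] (1),
  since I [1, v] (p k) = p I [1, k v] (1) and G = P K. As N acts trivially on W, this map factors
  through V_{N \<inter> K}, and Frobenius reciprocity for compact induction, which needs no topology, gives
  j(I). For I_0 no summation over (N \<inter> K)\<setminus>N is needed: it is the homomorphism with
  I_0 [1, v] (p k) = p [1, bar (k v)], where smoothness of V makes this function smooth. Applying
  j(I) pointwise to I_0 recovers I, that is I f (1) = j(I) (I_0 f (1)), and the three assertions
  follow by comparing both sides on the generators [1, v].
*)

theory Submission
  imports Defs
begin

section \<open>Representations and their endomorphism algebras\<close>

text \<open>The maps \<open>frob_j\<close> and \<open>I0\<close> are defined by \<open>THE\<close>,
  so nothing can be read off them before existence and uniqueness are known. Uniqueness rests on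
  generators: the translates of the functions [1, u] span c-Ind already under addition, and a
  homomorphism into Ind_P is tested by its values at one. Existence on c-Ind is a finite sum over
  the cosets of the support. For I_0 the obstacle is that p and k in g = p k are determined only up
  to an element of P \<inter> K. Its decomposition into N \<inter> K and M \<inter> K resolves this:
  the first factor disappears in the coinvariants and under inflation, the second passes through
  [1, -] and becomes part of the action of M. Multiplicativity of S' needs no computation of its
  own: it is assertion (iii) for the compactly induced representation of M as W and for the
  composite of I_0 and b as I.\<close>

lemma (in group_rep) act_zero [simp]:
  assumes "h \<in> carrier H"
  shows "act V h \<zero>\<^bsub>V\<^esub> = \<zero>\<^bsub>V\<^esub>"
  using act_smult[of h "\<zero>\<^bsub>C\<^esub>" "\<zero>\<^bsub>V\<^esub>"] act_closed[of h "\<zero>\<^bsub>V\<^esub>"] assms by simp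

lemma (in group_rep) act_inv_act:
  assumes "h \<in> carrier H" "v \<in> carrier V"
  shows "act V (inv\<^bsub>H\<^esub> h) (act V h v) = v" "act V h (act V (inv\<^bsub>H\<^esub> h) v) = v"
  using act_mult[of "inv\<^bsub>H\<^esub> h" h v] act_mult[of h "inv\<^bsub>H\<^esub> h" v] act_one[of v] assms
  by simp_all

lemma (in group_rep) act_eq_zero_iff:
  assumes "h \<in> carrier H" "v \<in> carrier V"
  shows "act V h v = \<zero>\<^bsub>V\<^esub> \<longleftrightarrow> v = \<zero>\<^bsub>V\<^esub>"
  using act_inv_act(1)[OF assms] assms by (metis H.inv_closed act_zero)

lemma (in group_rep) act_finsum:
  assumes "h \<in> carrier H" "finite A" "f \<in> A \<rightarrow> carrier V"
  shows "act V h (\<Oplus>\<^bsub>V\<^esub>a\<in>A. f a) = (\<Oplus>\<^bsub>V\<^esub>a\<in>A. act V h (f a))"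
  using assms(2,3)
proof (induction A rule: finite_induct)
  case (insert a A)
  then have "f \<in> A \<rightarrow> carrier V" "f a \<in> carrier V" by auto
  moreover from this assms(1) have "(\<lambda>a. act V h (f a)) \<in> A \<rightarrow> carrier V"
    by (auto intro: act_closed)
  ultimately show ?case
    using insert assms(1) by (simp add: act_add act_closed)
qed (use assms(1) in simp)

lemma (in group_rep) restrict:
  assumes "subgroup L H"
  shows "group_rep C (subgrp H L) V"
proof -
  interpret L: subgroup L H by fact
  have "group (subgrp H L)"
    using assms by (rule H.subgroup_imp_group)
  then show ?thesis
    by (intro group_rep.intro group_rep_axioms.intro V.module_axioms)
      (auto simp: act_closed act_add act_smult act_one act_mult)
qed

text \<open>Transport of structure along a surjection that respects all operations: each law of Q is
  the image of the same law of V. This is how the coinvariants become a representation, without any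
  coset arithmetic.\<close>

lemma group_rep_image:
  assumes "group_rep C H V"
    and image: "q ` carrier V = carrier Q"
    and add: "\<And>v w. \<lbrakk>v \<in> carrier V; w \<in> carrier V\<rbrakk> \<Longrightarrow> q (v \<oplus>\<^bsub>V\<^esub> w) = q v \<oplus>\<^bsub>Q\<^esub> q w"
    and zero: "q \<zero>\<^bsub>V\<^esub> = \<zero>\<^bsub>Q\<^esub>"
    and smult: "\<And>c v. \<lbrakk>c \<in> carrier C; v \<in> carrier V\<rbrakk> \<Longrightarrow> q (c \<odot>\<^bsub>V\<^esub> v) = c \<odot>\<^bsub>Q\<^esub> q v"
    and act: "\<And>h v. \<lbrakk>h \<in> carrier H; v \<in> carrier V\<rbrakk> \<Longrightarrow> q (act V h v) = act Q h (q v)"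
  shows "group_rep C H Q"
proof -
  interpret V: group_rep C H V by fact
  have ex: "\<exists>v\<in>carrier V. x = q v" if "x \<in> carrier Q" for x
    using that image by auto
  have q: "q v \<in> carrier Q" if "v \<in> carrier V" for v
    using that image by auto
  \<comment> \<open>The equations are oriented from Q back to V, so that both sides of a law in Q
    collapse to q applied to elements of V, where the law is known.\<close>
  note eqs = add[symmetric] zero[symmetric] smult[symmetric] act[symmetric]
  have grp: "abelian_group Q"
  proof (rule abelian_groupI)
    fix x y z assume "x \<in> carrier Q" "y \<in> carrier Q" "z \<in> carrier Q"
    then show "x \<oplus>\<^bsub>Q\<^esub> y \<oplus>\<^bsub>Q\<^esub> z = x \<oplus>\<^bsub>Q\<^esub> (y \<oplus>\<^bsub>Q\<^esub> z)"
      by (auto dest!: ex simp: eqs V.V.a_assoc)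
  next
    fix x y assume "x \<in> carrier Q" "y \<in> carrier Q"
    then show "x \<oplus>\<^bsub>Q\<^esub> y = y \<oplus>\<^bsub>Q\<^esub> x" "x \<oplus>\<^bsub>Q\<^esub> y \<in> carrier Q"
      by (auto dest!: ex simp: eqs q V.V.a_comm)
  next
    fix x assume "x \<in> carrier Q"
    then obtain v where v: "v \<in> carrier V" "x = q v" using ex by blast
    then show "\<zero>\<^bsub>Q\<^esub> \<oplus>\<^bsub>Q\<^esub> x = x" by (simp add: eqs)
    have "q (\<ominus>\<^bsub>V\<^esub> v) \<oplus>\<^bsub>Q\<^esub> x = \<zero>\<^bsub>Q\<^esub>"
      using v by (simp add: eqs V.V.l_neg)
    then show "\<exists>y\<in>carrier Q. y \<oplus>\<^bsub>Q\<^esub> x = \<zero>\<^bsub>Q\<^esub>"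
      using v q by (meson V.V.a_inv_closed)
  qed (simp add: eqs q)
  have mod: "module C Q"
    by (rule moduleI[OF V.V.is_cring grp])
      (auto dest!: ex simp: eqs q V.V.smult_l_distr V.V.smult_r_distr V.V.smult_assoc1)
  show ?thesis
    by (intro group_rep.intro group_rep_axioms.intro V.H.is_group mod)
      (auto dest!: ex simp: eqs q V.act_closed V.act_add V.act_smult V.act_one V.act_mult)
qed

section \<open>Homomorphisms and the endomorphism algebra\<close>

lemma rep_homI:
  assumes "f \<in> carrier V \<rightarrow>\<^sub>E carrier W"
    and "\<And>v v'. \<lbrakk>v \<in> carrier V; v' \<in> carrier V\<rbrakk> \<Longrightarrow> f (v \<oplus>\<^bsub>V\<^esub> v') = f v \<oplus>\<^bsub>W\<^esub> f v'"
    and "\<And>c v. \<lbrakk>c \<in> carrier C; v \<in> carrier V\<rbrakk> \<Longrightarrow> f (c \<odot>\<^bsub>V\<^esub> v) = c \<odot>\<^bsub>W\<^esub> f v"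
    and "\<And>h v. \<lbrakk>h \<in> carrier H; v \<in> carrier V\<rbrakk> \<Longrightarrow> f (act V h v) = act W h (f v)"
  shows "f \<in> rep_hom C H V W"
  using assms unfolding rep_hom_def by blast

lemma rep_homD:
  assumes "f \<in> rep_hom C H V W"
  shows "f \<in> carrier V \<rightarrow>\<^sub>E carrier W"
    and "v \<in> carrier V \<Longrightarrow> f v \<in> carrier W"
    and "\<lbrakk>v \<in> carrier V; v' \<in> carrier V\<rbrakk> \<Longrightarrow> f (v \<oplus>\<^bsub>V\<^esub> v') = f v \<oplus>\<^bsub>W\<^esub> f v'"
    and "\<lbrakk>c \<in> carrier C; v \<in> carrier V\<rbrakk> \<Longrightarrow> f (c \<odot>\<^bsub>V\<^esub> v) = c \<odot>\<^bsub>W\<^esub> f v"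
    and "\<lbrakk>h \<in> carrier H; v \<in> carrier V\<rbrakk> \<Longrightarrow> f (act V h v) = act W h (f v)"
  using assms unfolding rep_hom_def by (auto simp: PiE_iff)

lemma rep_hom_zero:
  assumes "group_rep C H V" "group_rep C H W" "f \<in> rep_hom C H V W"
  shows "f \<zero>\<^bsub>V\<^esub> = \<zero>\<^bsub>W\<^esub>"
proof -
  interpret V: group_rep C H V by fact
  interpret W: group_rep C H W by fact
  show ?thesis
    using rep_homD(4)[OF assms(3), of "\<zero>\<^bsub>C\<^esub>" "\<zero>\<^bsub>V\<^esub>"] rep_homD(2)[OF assms(3), of "\<zero>\<^bsub>V\<^esub>"]
    by simp
qed

lemma rep_hom_compose:
  assumes "group_rep C H U" "f \<in> rep_hom C H U V" "g \<in> rep_hom C H V W"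
  shows "compose (carrier U) g f \<in> rep_hom C H U W"
proof -
  interpret U: group_rep C H U by fact
  note f = rep_homD[OF assms(2)] and g = rep_homD[OF assms(3)]
  show ?thesis
    by (rule rep_homI) (auto simp: compose_def f g U.act_closed)
qed

lemma rep_hom_add:
  assumes "group_rep C H V" "group_rep C H W" "f \<in> rep_hom C H V W" "g \<in> rep_hom C H V W"
  shows "(\<lambda>v\<in>carrier V. f v \<oplus>\<^bsub>W\<^esub> g v) \<in> rep_hom C H V W"
proof -
  interpret V: group_rep C H V by fact
  interpret W: group_rep C H W by fact
  note f = rep_homD[OF assms(3)] and g = rep_homD[OF assms(4)]
  show ?thesis
    by (rule rep_homI)
      (auto simp: f g V.act_closed W.act_add W.V.smult_r_distr W.V.a_ac)
qed

lemma rep_hom_smult: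
  assumes "group_rep C H V" "group_rep C H W" "f \<in> rep_hom C H V W" "c \<in> carrier C"
  shows "(\<lambda>v\<in>carrier V. c \<odot>\<^bsub>W\<^esub> f v) \<in> rep_hom C H V W"
proof -
  interpret V: group_rep C H V by fact
  interpret W: group_rep C H W by fact
  note f = rep_homD[OF assms(3)]
  \<comment> \<open>Commutativity of C is what makes a scalar multiple of a homomorphism
    C-linear.\<close>
  have "c \<odot>\<^bsub>W\<^esub> (d \<odot>\<^bsub>W\<^esub> w) = d \<odot>\<^bsub>W\<^esub> (c \<odot>\<^bsub>W\<^esub> w)"
    if "d \<in> carrier C" "w \<in> carrier W" for d w
    using that assms(4) by (metis W.V.smult_assoc1 V.V.m_comm)
  then show ?thesis
    using assms(4) by (intro rep_homI)
      (auto simp: f V.act_closed W.act_smult W.V.smult_r_distr)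
qed

lemma rep_hom_id:
  assumes "group_rep C H V"
  shows "(\<lambda>v\<in>carrier V. v) \<in> rep_hom C H V V"
proof -
  interpret V: group_rep C H V by fact
  show ?thesis by (rule rep_homI) (auto simp: V.act_closed)
qed

lemma End_alg_simps:
  "carrier (End_alg C H V) = rep_hom C H V V"
  "f \<otimes>\<^bsub>End_alg C H V\<^esub> g = compose (carrier V) f g"
  "\<one>\<^bsub>End_alg C H V\<^esub> = (\<lambda>v\<in>carrier V. v)"
  "\<zero>\<^bsub>End_alg C H V\<^esub> = (\<lambda>v\<in>carrier V. \<zero>\<^bsub>V\<^esub>)"
  "f \<oplus>\<^bsub>End_alg C H V\<^esub> g = (\<lambda>v\<in>carrier V. f v \<oplus>\<^bsub>V\<^esub> g v)"
  "c \<odot>\<^bsub>End_alg C H V\<^esub> f = (\<lambda>v\<in>carrier V. c \<odot>\<^bsub>V\<^esub> f v)"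
  by (simp_all add: End_alg_def)

lemma assoc_algebra_End_alg:
  assumes "group_rep C H V"
  shows "assoc_algebra C (End_alg C H V)"
proof -
  interpret V: group_rep C H V by fact
  let ?E = "End_alg C H V"
  have ext: "f = g" if "f \<in> carrier ?E" "g \<in> carrier ?E" "\<And>v. v \<in> carrier V \<Longrightarrow> f v = g v" for f g
    using that by (auto simp: End_alg_simps dest!: rep_homD(1) intro: PiE_ext)
  have closed: "f \<oplus>\<^bsub>?E\<^esub> g \<in> carrier ?E" "f \<otimes>\<^bsub>?E\<^esub> g \<in> carrier ?E"
    if "f \<in> carrier ?E" "g \<in> carrier ?E" for f g
    using that assms by (auto simp: End_alg_simps intro: rep_hom_add rep_hom_compose)
  have smult: "c \<odot>\<^bsub>?E\<^esub> f \<in> carrier ?E" if "c \<in> carrier C" "f \<in> carrier ?E" for c f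
    using that assms by (auto simp: End_alg_simps intro: rep_hom_smult)
  have one: "\<one>\<^bsub>?E\<^esub> \<in> carrier ?E"
    using assms by (simp add: End_alg_simps rep_hom_id)
  have zero: "\<zero>\<^bsub>?E\<^esub> \<in> carrier ?E"
    by (auto simp: End_alg_simps V.act_closed intro!: rep_homI)
  have app: "f v \<in> carrier V" "f (v \<oplus>\<^bsub>V\<^esub> w) = f v \<oplus>\<^bsub>V\<^esub> f w"
    "c \<in> carrier C \<Longrightarrow> f (c \<odot>\<^bsub>V\<^esub> v) = c \<odot>\<^bsub>V\<^esub> f v"
    if "f \<in> carrier ?E" "v \<in> carrier V" "w \<in> carrier V" for f v w c
    using that by (auto simp: End_alg_simps rep_homD)
  have val: "(f \<oplus>\<^bsub>?E\<^esub> g) v = f v \<oplus>\<^bsub>V\<^esub> g v" "(f \<otimes>\<^bsub>?E\<^esub> g) v = f (g v)"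
    "\<zero>\<^bsub>?E\<^esub> v = \<zero>\<^bsub>V\<^esub>" "\<one>\<^bsub>?E\<^esub> v = v" "(c \<odot>\<^bsub>?E\<^esub> f) v = c \<odot>\<^bsub>V\<^esub> f v"
    if "v \<in> carrier V" for f g v c
    using that by (auto simp: End_alg_simps compose_def)
  have grp: "abelian_group ?E"
  proof (rule abelian_groupI)
    fix f assume f: "f \<in> carrier ?E"
    \<comment> \<open>The negative of f is taken as the scalar multiple by -1, so that closure under
      scalars already places it in the carrier.\<close>
    let ?g = "(\<ominus>\<^bsub>C\<^esub> \<one>\<^bsub>C\<^esub>) \<odot>\<^bsub>?E\<^esub> f"
    have "?g \<in> carrier ?E" using f by (simp add: smult)
    moreover from this have "?g \<oplus>\<^bsub>?E\<^esub> f = \<zero>\<^bsub>?E\<^esub>"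
      using f by (intro ext) (auto simp: closed zero val app V.V.smult_l_minus V.V.l_neg)
    ultimately show "\<exists>g\<in>carrier ?E. g \<oplus>\<^bsub>?E\<^esub> f = \<zero>\<^bsub>?E\<^esub>" by blast
  qed (auto simp: closed zero val app V.V.a_ac intro!: ext)
  have mod: "module C ?E"
    by (rule moduleI[OF V.V.is_cring grp])
      (auto simp: closed smult val app V.V.smult_l_distr V.V.smult_r_distr V.V.smult_assoc1 intro!: ext)
  have ring: "ring ?E"
    by (rule ringI[OF grp]) (auto simp: closed one val app intro!: ext monoidI)
  show ?thesis
    by (intro assoc_algebra.intro assoc_algebra_axioms.intro mod ring)
      (auto simp: closed smult val app intro!: ext)
qed

section \<open>Representations on functions\<close>

lemma fun_rep_simps [simp]:
  "carrier (fun_rep H V S) = S"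
  "\<zero>\<^bsub>fun_rep H V S\<^esub> = (\<lambda>g\<in>carrier H. \<zero>\<^bsub>V\<^esub>)"
  "f \<oplus>\<^bsub>fun_rep H V S\<^esub> f' = (\<lambda>g\<in>carrier H. f g \<oplus>\<^bsub>V\<^esub> f' g)"
  "c \<odot>\<^bsub>fun_rep H V S\<^esub> f = (\<lambda>g\<in>carrier H. c \<odot>\<^bsub>V\<^esub> f g)"
  "act (fun_rep H V S) x f = (\<lambda>g\<in>carrier H. f (g \<otimes>\<^bsub>H\<^esub> x))"
  by (simp_all add: fun_rep_def)

text \<open>All operations except translation are pointwise, so the laws are inherited from V and H
  and only the closure of S has to be supplied. It serves for the equivariant functions, for c-Ind
  and for smooth induction.\<close>

lemma group_rep_fun_rep:
  assumes "group H" "module C V" and S: "S \<subseteq> carrier H \<rightarrow>\<^sub>E carrier V"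
    and zero: "(\<lambda>g\<in>carrier H. \<zero>\<^bsub>V\<^esub>) \<in> S"
    and add: "\<And>f f'. \<lbrakk>f \<in> S; f' \<in> S\<rbrakk> \<Longrightarrow> (\<lambda>g\<in>carrier H. f g \<oplus>\<^bsub>V\<^esub> f' g) \<in> S"
    and smult: "\<And>c f. \<lbrakk>c \<in> carrier C; f \<in> S\<rbrakk> \<Longrightarrow> (\<lambda>g\<in>carrier H. c \<odot>\<^bsub>V\<^esub> f g) \<in> S"
    and act: "\<And>x f. \<lbrakk>x \<in> carrier H; f \<in> S\<rbrakk> \<Longrightarrow> (\<lambda>g\<in>carrier H. f (g \<otimes>\<^bsub>H\<^esub> x)) \<in> S"
  shows "group_rep C H (fun_rep H V S)"
proof -
  interpret H: group H by fact
  interpret V: module C V by fact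
  have app: "f g \<in> carrier V" if "f \<in> S" "g \<in> carrier H" for f g
    using that S by (auto simp: PiE_iff)
  have ext: "f = f'" if "f \<in> S" "f' \<in> S" "\<And>g. g \<in> carrier H \<Longrightarrow> f g = f' g" for f f'
    using that S by (meson PiE_ext subsetD)
  let ?F = "fun_rep H V S"
  have closed: "\<zero>\<^bsub>?F\<^esub> \<in> S" "\<And>f f'. \<lbrakk>f \<in> S; f' \<in> S\<rbrakk> \<Longrightarrow> f \<oplus>\<^bsub>?F\<^esub> f' \<in> S"
    "\<And>c f. \<lbrakk>c \<in> carrier C; f \<in> S\<rbrakk> \<Longrightarrow> c \<odot>\<^bsub>?F\<^esub> f \<in> S"
    "\<And>x f. \<lbrakk>x \<in> carrier H; f \<in> S\<rbrakk> \<Longrightarrow> act ?F x f \<in> S"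
    using zero add smult act by simp_all
  have val: "\<zero>\<^bsub>?F\<^esub> g = \<zero>\<^bsub>V\<^esub>" "(f \<oplus>\<^bsub>?F\<^esub> f') g = f g \<oplus>\<^bsub>V\<^esub> f' g"
    "(c \<odot>\<^bsub>?F\<^esub> f) g = c \<odot>\<^bsub>V\<^esub> f g" "act ?F x f g = f (g \<otimes>\<^bsub>H\<^esub> x)"
    if "g \<in> carrier H" for f f' c x g
    using that by simp_all
  \<comment> \<open>From here on the operations stay folded and are evaluated only at points,
    through \<open>val\<close>, after \<open>ext\<close> has reduced a law to its values.\<close>
  note [simp del] = fun_rep_simps(2-)
  have grp: "abelian_group ?F"
  proof (rule abelian_groupI)
    fix f assume "f \<in> carrier ?F"
    then have f: "f \<in> S" by simp
    let ?g = "(\<ominus>\<^bsub>C\<^esub> \<one>\<^bsub>C\<^esub>) \<odot>\<^bsub>?F\<^esub> f"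
    have "?g \<in> S" using f by (simp add: closed)
    moreover from this have "?g \<oplus>\<^bsub>?F\<^esub> f = \<zero>\<^bsub>?F\<^esub>"
      using f by (intro ext) (simp_all add: closed val app V.smult_l_minus V.l_neg)
    ultimately show "\<exists>g\<in>carrier ?F. g \<oplus>\<^bsub>?F\<^esub> f = \<zero>\<^bsub>?F\<^esub>"
      by auto
  qed (simp_all add: closed, (rule ext; simp add: closed val app V.a_ac)+)
  have mod: "module C ?F"
    by (rule moduleI[OF V.is_cring grp]; (rule ext)?)
      (simp_all add: closed val app V.smult_l_distr V.smult_r_distr V.smult_assoc1)
  show ?thesis
    by (intro group_rep.intro group_rep_axioms.intro mod \<open>group H\<close>; (rule ext)?)
      (simp_all add: closed val app H.m_assoc)
qed

section \<open>Compact induction and Frobenius reciprocity\<close>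

text \<open>One setting for all inductions: it is used for K in G with V, for M \<inter> K in M with
  the coinvariants, and for P in G with an inflated representation.\<close>

locale subgroup_rep = H: group H + L: subgroup L H + U: group_rep C "subgrp H L" U
  for C :: "('c, 'k) ring_scheme" and H :: "('g, 'm) monoid_scheme" and L
    and U :: "('c, 'v, 'g) rep"
begin

lemma equivariant_funsI:
  assumes "f \<in> carrier H \<rightarrow>\<^sub>E carrier U"
    and "\<And>x g. \<lbrakk>x \<in> L; g \<in> carrier H\<rbrakk> \<Longrightarrow> f (x \<otimes>\<^bsub>H\<^esub> g) = act U x (f g)"
  shows "f \<in> equivariant_funs H L U"
  using assms by (simp add: equivariant_funs_def)

lemma equivariant_funsD:
  assumes "f \<in> equivariant_funs H L U"
  shows "f \<in> carrier H \<rightarrow>\<^sub>E carrier U"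
    and "g \<in> carrier H \<Longrightarrow> f g \<in> carrier U"
    and "\<lbrakk>x \<in> L; g \<in> carrier H\<rbrakk> \<Longrightarrow> f (x \<otimes>\<^bsub>H\<^esub> g) = act U x (f g)"
  using assms by (auto simp: equivariant_funs_def PiE_iff)

lemma act_U:
  assumes "x \<in> L" "u \<in> carrier U"
  shows "act U x u \<in> carrier U" "act U x u = \<zero>\<^bsub>U\<^esub> \<longleftrightarrow> u = \<zero>\<^bsub>U\<^esub>"
    "v \<in> carrier U \<Longrightarrow> act U x (u \<oplus>\<^bsub>U\<^esub> v) = act U x u \<oplus>\<^bsub>U\<^esub> act U x v"
    "c \<in> carrier C \<Longrightarrow> act U x (c \<odot>\<^bsub>U\<^esub> u) = c \<odot>\<^bsub>U\<^esub> act U x u"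
    "y \<in> L \<Longrightarrow> act U (x \<otimes>\<^bsub>H\<^esub> y) u = act U x (act U y u)"
    "act U x \<zero>\<^bsub>U\<^esub> = \<zero>\<^bsub>U\<^esub>"
  using assms U.act_closed[of x u] U.act_eq_zero_iff[of x u] U.act_add[of x u v]
    U.act_smult[of x c u] U.act_mult[of x y u] by simp_all

lemma act_U_one: "u \<in> carrier U \<Longrightarrow> act U \<one>\<^bsub>H\<^esub> u = u"
  using U.act_one by simp

lemma equivariant_funs_closed:
  shows "(\<lambda>g\<in>carrier H. \<zero>\<^bsub>U\<^esub>) \<in> equivariant_funs H L U"
    and "\<lbrakk>f \<in> equivariant_funs H L U; f' \<in> equivariant_funs H L U\<rbrakk> \<Longrightarrow>
      (\<lambda>g\<in>carrier H. f g \<oplus>\<^bsub>U\<^esub> f' g) \<in> equivariant_funs H L U"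
    and "\<lbrakk>c \<in> carrier C; f \<in> equivariant_funs H L U\<rbrakk> \<Longrightarrow>
      (\<lambda>g\<in>carrier H. c \<odot>\<^bsub>U\<^esub> f g) \<in> equivariant_funs H L U"
    and "\<lbrakk>x \<in> carrier H; f \<in> equivariant_funs H L U\<rbrakk> \<Longrightarrow>
      (\<lambda>g\<in>carrier H. f (g \<otimes>\<^bsub>H\<^esub> x)) \<in> equivariant_funs H L U"
  by (rule equivariant_funsI; auto simp: equivariant_funsD act_U H.m_assoc)+

lemma group_rep_equivariant_funs: "group_rep C H (fun_rep H U (equivariant_funs H L U))"
  by (rule group_rep_fun_rep[OF H.is_group U.V.module_axioms])
    (simp_all add: equivariant_funs_closed subsetI[OF equivariant_funsD(1)])

text \<open>The support is recorded as a set of cosets. The support condition of \<open>cInd\<close>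
  then becomes finiteness of this set, the set is easy to bound under sums and translations, and it
  is the index set of the sums that extend homomorphisms.\<close>

definition supp_cosets :: "('g \<Rightarrow> 'v) \<Rightarrow> 'g set set"
  where "supp_cosets f = (\<lambda>g. L #>\<^bsub>H\<^esub> g) ` {g \<in> carrier H. f g \<noteq> \<zero>\<^bsub>U\<^esub>}"

lemma in_rcosD:
  assumes "x \<in> L #>\<^bsub>H\<^esub> a" "a \<in> carrier H"
  obtains l where "l \<in> L" "x = l \<otimes>\<^bsub>H\<^esub> a"
  using assms by (auto simp: r_coset_def)

lemma in_rcos_iff:
  assumes "x \<in> carrier H" "a \<in> carrier H"
  shows "x \<in> L #>\<^bsub>H\<^esub> a \<longleftrightarrow> x \<otimes>\<^bsub>H\<^esub> inv\<^bsub>H\<^esub> a \<in> L"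
  using assms by (auto simp: r_coset_def H.m_assoc intro!: bexI[of _ "x \<otimes>\<^bsub>H\<^esub> inv\<^bsub>H\<^esub> a"])

lemma rcos_eqI: "\<lbrakk>x \<in> L #>\<^bsub>H\<^esub> a; a \<in> carrier H\<rbrakk> \<Longrightarrow> L #>\<^bsub>H\<^esub> x = L #>\<^bsub>H\<^esub> a"
  using H.repr_independence[OF _ _ L.subgroup_axioms] by blast

lemma rcos_self: "a \<in> carrier H \<Longrightarrow> a \<in> L #>\<^bsub>H\<^esub> a"
  using H.rcos_self L.subgroup_axioms by blast

lemma nonzero_on_coset:
  assumes "f \<in> equivariant_funs H L U" "a \<in> carrier H" "x \<in> L #>\<^bsub>H\<^esub> a"
  shows "f x \<noteq> \<zero>\<^bsub>U\<^esub> \<longleftrightarrow> f a \<noteq> \<zero>\<^bsub>U\<^esub>"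
  using assms by (auto elim!: in_rcosD simp: equivariant_funsD act_U)

lemma in_supp_cosets_iff:
  assumes "f \<in> equivariant_funs H L U" "a \<in> carrier H"
  shows "L #>\<^bsub>H\<^esub> a \<in> supp_cosets f \<longleftrightarrow> f a \<noteq> \<zero>\<^bsub>U\<^esub>"
proof
  assume "L #>\<^bsub>H\<^esub> a \<in> supp_cosets f"
  then obtain b where "b \<in> carrier H" "f b \<noteq> \<zero>\<^bsub>U\<^esub>" "L #>\<^bsub>H\<^esub> a = L #>\<^bsub>H\<^esub> b"
    by (auto simp: supp_cosets_def)
  then show "f a \<noteq> \<zero>\<^bsub>U\<^esub>"
    using nonzero_on_coset[of f b a] assms rcos_self[of a] by auto
qed (use assms in \<open>auto simp: supp_cosets_def\<close>)

text \<open>An element of L acts invertibly, so an equivariant function vanishes at all points of a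
  coset or at none. Its support is therefore a union of cosets, and the only condition left is that
  there are finitely many.\<close>

lemma carrier_cInd_iff:
  "f \<in> carrier (cInd H L U) \<longleftrightarrow> f \<in> equivariant_funs H L U \<and> finite (supp_cosets f)"
proof
  assume "f \<in> carrier (cInd H L U)"
  then obtain A where f: "f \<in> equivariant_funs H L U"
    and A: "finite A" "A \<subseteq> carrier H" "{g \<in> carrier H. f g \<noteq> \<zero>\<^bsub>U\<^esub>} = (\<Union>a\<in>A. L #>\<^bsub>H\<^esub> a)"
    by (auto simp: cInd_def)
  have "supp_cosets f \<subseteq> (\<lambda>a. L #>\<^bsub>H\<^esub> a) ` A"
    unfolding supp_cosets_def A(3) using A(2) rcos_eqI by blast
  with f A(1) show "f \<in> equivariant_funs H L U \<and> finite (supp_cosets f)"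
    using finite_subset by blast
next
  assume f: "f \<in> equivariant_funs H L U \<and> finite (supp_cosets f)"
  let ?S = "{g \<in> carrier H. f g \<noteq> \<zero>\<^bsub>U\<^esub>}"
  \<comment> \<open>The representatives are chosen inside the support, so that their whole cosets
    lie in it.\<close>
  obtain A where A: "A \<subseteq> ?S" "finite A" "supp_cosets f = (\<lambda>a. L #>\<^bsub>H\<^esub> a) ` A"
    using f finite_subset_image[of "supp_cosets f" "\<lambda>a. L #>\<^bsub>H\<^esub> a" ?S]
    by (auto simp: supp_cosets_def)
  have "x \<in> (\<Union>a\<in>A. L #>\<^bsub>H\<^esub> a)" if "x \<in> ?S" for x
  proof -
    have "L #>\<^bsub>H\<^esub> x \<in> supp_cosets f" using that by (auto simp: supp_cosets_def)
    then show ?thesis using A(3) rcos_self that by auto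
  qed
  moreover have "x \<in> ?S" if "a \<in> A" "x \<in> L #>\<^bsub>H\<^esub> a" for a x
    using that A(1) nonzero_on_coset[of f a x] f H.r_coset_subset_G[OF L.subset, of a] by auto
  ultimately have "?S = (\<Union>a\<in>A. L #>\<^bsub>H\<^esub> a)" by blast
  with f A(1,2) show "f \<in> carrier (cInd H L U)"
    by (auto simp: cInd_def)
qed

lemma cInd_simps [simp]:
  "\<zero>\<^bsub>cInd H L U\<^esub> = (\<lambda>g\<in>carrier H. \<zero>\<^bsub>U\<^esub>)"
  "f \<oplus>\<^bsub>cInd H L U\<^esub> f' = (\<lambda>g\<in>carrier H. f g \<oplus>\<^bsub>U\<^esub> f' g)"
  "c \<odot>\<^bsub>cInd H L U\<^esub> f = (\<lambda>g\<in>carrier H. c \<odot>\<^bsub>U\<^esub> f g)"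
  "act (cInd H L U) x f = (\<lambda>g\<in>carrier H. f (g \<otimes>\<^bsub>H\<^esub> x))"
  by (simp_all add: cInd_def)

lemma supp_cosets_add:
  "supp_cosets (\<lambda>g\<in>carrier H. f g \<oplus>\<^bsub>U\<^esub> f' g) \<subseteq> supp_cosets f \<union> supp_cosets f'"
  by (auto simp: supp_cosets_def image_iff) (metis U.V.zero_closed U.V.l_zero)

lemma supp_cosets_smult:
  "c \<in> carrier C \<Longrightarrow> supp_cosets (\<lambda>g\<in>carrier H. c \<odot>\<^bsub>U\<^esub> f g) \<subseteq> supp_cosets f"
  by (force simp: supp_cosets_def)

text \<open>A point g of the support of f corresponds to the point g times \<open>inv x\<close> of
  the support of the translate. The exact image, and not just a bound, is used later to reindex a
  sum.\<close>

lemma supp_cosets_act: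
  assumes "x \<in> carrier H"
  shows "supp_cosets (\<lambda>g\<in>carrier H. f (g \<otimes>\<^bsub>H\<^esub> x)) = (\<lambda>X. X #>\<^bsub>H\<^esub> inv\<^bsub>H\<^esub> x) ` supp_cosets f"
proof -
  have "{g \<in> carrier H. f (g \<otimes>\<^bsub>H\<^esub> x) \<noteq> \<zero>\<^bsub>U\<^esub>} =
      (\<lambda>g. g \<otimes>\<^bsub>H\<^esub> inv\<^bsub>H\<^esub> x) ` {g \<in> carrier H. f g \<noteq> \<zero>\<^bsub>U\<^esub>}"
  proof (intro equalityI subsetI)
    fix g assume "g \<in> {g \<in> carrier H. f (g \<otimes>\<^bsub>H\<^esub> x) \<noteq> \<zero>\<^bsub>U\<^esub>}"
    then show "g \<in> (\<lambda>g. g \<otimes>\<^bsub>H\<^esub> inv\<^bsub>H\<^esub> x) ` {g \<in> carrier H. f g \<noteq> \<zero>\<^bsub>U\<^esub>}"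
      using assms by (intro image_eqI[of _ _ "g \<otimes>\<^bsub>H\<^esub> x"]) (simp_all add: H.m_assoc)
  qed (use assms in \<open>auto simp: H.m_assoc\<close>)
  then have "supp_cosets (\<lambda>g\<in>carrier H. f (g \<otimes>\<^bsub>H\<^esub> x)) =
      (\<lambda>g. L #>\<^bsub>H\<^esub> (g \<otimes>\<^bsub>H\<^esub> inv\<^bsub>H\<^esub> x)) ` {g \<in> carrier H. f g \<noteq> \<zero>\<^bsub>U\<^esub>}"
    by (simp add: supp_cosets_def image_image cong: conj_cong)
  also have "\<dots> = (\<lambda>X. X #>\<^bsub>H\<^esub> inv\<^bsub>H\<^esub> x) ` supp_cosets f"
    unfolding supp_cosets_def image_image
    using assms by (intro image_cong) (simp_all add: H.coset_mult_assoc[OF L.subset])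
  finally show ?thesis .
qed

lemma group_rep_cInd: "group_rep C H (cInd H L U)"
proof -
  let ?S = "carrier (cInd H L U)"
  have "group_rep C H (fun_rep H U ?S)"
  proof (rule group_rep_fun_rep[OF H.is_group U.V.module_axioms])
    show "?S \<subseteq> carrier H \<rightarrow>\<^sub>E carrier U"
      using equivariant_funsD(1) by (meson carrier_cInd_iff subsetI)
    have "supp_cosets (\<lambda>g\<in>carrier H. \<zero>\<^bsub>U\<^esub>) = {}"
      by (simp add: supp_cosets_def)
    then show "(\<lambda>g\<in>carrier H. \<zero>\<^bsub>U\<^esub>) \<in> ?S"
      by (simp add: carrier_cInd_iff equivariant_funs_closed)
    show "(\<lambda>g\<in>carrier H. f g \<oplus>\<^bsub>U\<^esub> f' g) \<in> ?S" if "f \<in> ?S" "f' \<in> ?S" for f f'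
      using that finite_subset[OF supp_cosets_add]
      by (simp add: carrier_cInd_iff equivariant_funs_closed)
    show "(\<lambda>g\<in>carrier H. c \<odot>\<^bsub>U\<^esub> f g) \<in> ?S" if "c \<in> carrier C" "f \<in> ?S" for c f
      using that finite_subset[OF supp_cosets_smult]
      by (simp add: carrier_cInd_iff equivariant_funs_closed)
    show "(\<lambda>g\<in>carrier H. f (g \<otimes>\<^bsub>H\<^esub> x)) \<in> ?S" if "x \<in> carrier H" "f \<in> ?S" for x f
      using that by (simp add: carrier_cInd_iff equivariant_funs_closed supp_cosets_act)
  qed
  then show ?thesis by (simp add: cInd_def)
qed

section \<open>The functions [1, u] and generation of c-Ind\<close>

lemma cInd_elem_apply:
  "g \<in> carrier H \<Longrightarrow> cInd_elem H L U u g = (if g \<in> L then act U g u else \<zero>\<^bsub>U\<^esub>)"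
  by (simp add: cInd_elem_def)

lemma supp_cosets_cInd_elem: "supp_cosets (cInd_elem H L U u) \<subseteq> {L}"
  by (auto simp: supp_cosets_def cInd_elem_apply H.coset_join2 L.subgroup_axioms split: if_splits)

lemma cInd_elem_closed:
  assumes "u \<in> carrier U"
  shows "cInd_elem H L U u \<in> carrier (cInd H L U)"
proof -
  have "x \<otimes>\<^bsub>H\<^esub> g \<in> L \<longleftrightarrow> g \<in> L" if "x \<in> L" "g \<in> carrier H" for x g
  proof
    assume "x \<otimes>\<^bsub>H\<^esub> g \<in> L"
    then have "inv\<^bsub>H\<^esub> x \<otimes>\<^bsub>H\<^esub> (x \<otimes>\<^bsub>H\<^esub> g) \<in> L" using that by blast
    then show "g \<in> L" using that by (simp flip: H.m_assoc)
  qed (use that in auto)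
  moreover have "cInd_elem H L U u \<in> extensional (carrier H)"
    by (simp add: cInd_elem_def)
  ultimately have "cInd_elem H L U u \<in> equivariant_funs H L U"
    using assms by (intro equivariant_funsI) (auto simp: cInd_elem_apply act_U PiE_iff)
  then show ?thesis
    using finite_subset[OF supp_cosets_cInd_elem] by (simp add: carrier_cInd_iff)
qed

text \<open>Both functions live on L, where their values at g are (g l) u and g (l u). It later
  serves to move an element of the inducing subgroup between the function and its argument
  u.\<close>

lemma cInd_elem_act:
  assumes "l \<in> L" "u \<in> carrier U"
  shows "act (cInd H L U) l (cInd_elem H L U u) = cInd_elem H L U (act U l u)"
proof (rule extensionalityI[of _ "carrier H"])
  fix g assume g: "g \<in> carrier H"
  have "g \<otimes>\<^bsub>H\<^esub> l \<in> L \<longleftrightarrow> g \<in> L"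
  proof
    assume "g \<otimes>\<^bsub>H\<^esub> l \<in> L"
    then have "g \<otimes>\<^bsub>H\<^esub> l \<otimes>\<^bsub>H\<^esub> inv\<^bsub>H\<^esub> l \<in> L" using assms by blast
    then show "g \<in> L" using g assms by (simp add: H.m_assoc)
  qed (use assms in auto)
  then show "act (cInd H L U) l (cInd_elem H L U u) g = cInd_elem H L U (act U l u) g"
    using g assms by (simp add: cInd_elem_apply act_U)
qed (simp_all add: cInd_elem_def)

lemma cInd_elem_linear:
  assumes "u \<in> carrier U"
  shows "v \<in> carrier U \<Longrightarrow> cInd_elem H L U (u \<oplus>\<^bsub>U\<^esub> v) =
      cInd_elem H L U u \<oplus>\<^bsub>cInd H L U\<^esub> cInd_elem H L U v"
    and "c \<in> carrier C \<Longrightarrow> cInd_elem H L U (c \<odot>\<^bsub>U\<^esub> u) =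
      c \<odot>\<^bsub>cInd H L U\<^esub> cInd_elem H L U u"
  using assms by (auto simp: cInd_elem_def act_U)

text \<open>Induction on the number of cosets in the support, splitting off one coset at a time. The
  function restricted to L a is the translate by \<open>inv a\<close> of [1, f a], so sums of
  translated generators exhaust c-Ind and scalars need no case.\<close>

lemma cInd_induct [consumes 1, case_names elem add]:
  assumes "f \<in> carrier (cInd H L U)"
    and elem: "\<And>g u. \<lbrakk>g \<in> carrier H; u \<in> carrier U\<rbrakk> \<Longrightarrow>
      Q (act (cInd H L U) g (cInd_elem H L U u))"
    and add: "\<And>f f'. \<lbrakk>f \<in> carrier (cInd H L U); f' \<in> carrier (cInd H L U); Q f; Q f'\<rbrakk> \<Longrightarrow>
      Q (f \<oplus>\<^bsub>cInd H L U\<^esub> f')"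
  shows "Q f"
  using assms(1)
proof (induction "card (supp_cosets f)" arbitrary: f rule: less_induct)
  case less
  interpret I: group_rep C H "cInd H L U" by (rule group_rep_cInd)
  have f: "f \<in> equivariant_funs H L U" "finite (supp_cosets f)"
    using less.prems by (auto simp: carrier_cInd_iff)
  show ?case
  proof (cases "supp_cosets f = {}")
    case True
    then have "f g = \<zero>\<^bsub>U\<^esub>" if "g \<in> carrier H" for g
      using that by (auto simp: supp_cosets_def)
    \<comment> \<open>The zero function is itself the generator with value zero, so the base case
      falls under \<open>elem\<close>.\<close>
    then have "f = act (cInd H L U) \<one>\<^bsub>H\<^esub> (cInd_elem H L U \<zero>\<^bsub>U\<^esub>)"
      using equivariant_funsD(1)[OF f(1)]
      by (intro extensionalityI[of _ "carrier H"]) (auto simp: cInd_elem_apply act_U PiE_iff)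
    then show ?thesis using elem[of "\<one>\<^bsub>H\<^esub>" "\<zero>\<^bsub>U\<^esub>"] by simp
  next
    case False
    then obtain a where a: "a \<in> carrier H" "f a \<noteq> \<zero>\<^bsub>U\<^esub>"
      by (auto simp: supp_cosets_def)
    \<comment> \<open>\<open>f'\<close> is f with the coset L a cleared, and \<open>d\<close> is the
      part removed, written as a translated generator.\<close>
    define f' where "f' = (\<lambda>g\<in>carrier H. if g \<in> L #>\<^bsub>H\<^esub> a then \<zero>\<^bsub>U\<^esub> else f g)"
    define d where "d = act (cInd H L U) (inv\<^bsub>H\<^esub> a) (cInd_elem H L U (f a))"
    have fa: "f a \<in> carrier U" using f(1) a(1) by (rule equivariant_funsD(2))
    have d: "d \<in> carrier (cInd H L U)"
      using a fa unfolding d_def by (intro I.act_closed cInd_elem_closed) auto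
    have d_apply: "d g = (if g \<in> L #>\<^bsub>H\<^esub> a then f g else \<zero>\<^bsub>U\<^esub>)" if g: "g \<in> carrier H" for g
    proof (cases "g \<in> L #>\<^bsub>H\<^esub> a")
      case True
      then have "g \<otimes>\<^bsub>H\<^esub> inv\<^bsub>H\<^esub> a \<in> L" using in_rcos_iff a g by simp
      moreover have "f g = act U (g \<otimes>\<^bsub>H\<^esub> inv\<^bsub>H\<^esub> a) (f a)"
        using equivariant_funsD(3)[OF f(1) calculation a(1)] a g by (simp add: H.m_assoc)
      ultimately show ?thesis using True a g by (simp add: d_def cInd_elem_apply)
    qed (use in_rcos_iff a g in \<open>simp add: d_def cInd_elem_apply\<close>)
    have f'_eq: "f' \<in> equivariant_funs H L U"
    proof (rule equivariant_funsI)
      fix x g assume x: "x \<in> L" "g \<in> carrier H"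
      then have "L #>\<^bsub>H\<^esub> (x \<otimes>\<^bsub>H\<^esub> g) = L #>\<^bsub>H\<^esub> g"
        by (intro rcos_eqI) (auto simp: r_coset_def)
      then have "x \<otimes>\<^bsub>H\<^esub> g \<in> L #>\<^bsub>H\<^esub> a \<longleftrightarrow> g \<in> L #>\<^bsub>H\<^esub> a"
        using x a rcos_eqI rcos_self by (metis H.m_closed L.mem_carrier)
      then show "f' (x \<otimes>\<^bsub>H\<^esub> g) = act U x (f' g)"
        using x equivariant_funsD[OF f(1)] by (auto simp: f'_def act_U)
    qed (use equivariant_funsD[OF f(1)] in \<open>auto simp: f'_def\<close>)
    have "supp_cosets f' \<subseteq> supp_cosets f"
      by (auto simp: supp_cosets_def f'_def)
    moreover have "L #>\<^bsub>H\<^esub> a \<notin> supp_cosets f'"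
      using in_supp_cosets_iff[OF f'_eq a(1)] a rcos_self by (simp add: f'_def)
    moreover have "L #>\<^bsub>H\<^esub> a \<in> supp_cosets f"
      using in_supp_cosets_iff[OF f(1) a(1)] a by simp
    ultimately have sub: "supp_cosets f' \<subset> supp_cosets f" by blast
    then have f': "f' \<in> carrier (cInd H L U)"
      using f'_eq f(2) finite_subset by (auto simp: carrier_cInd_iff)
    have "f = f' \<oplus>\<^bsub>cInd H L U\<^esub> d"
      using equivariant_funsD[OF f(1)]
      by (intro extensionalityI[of _ "carrier H"]) (auto simp: d_apply f'_def PiE_iff)
    moreover have "Q f'"
      using less.hyps[OF psubset_card_mono[OF f(2) sub] f'] .
    moreover have "Q d"
      unfolding d_def using elem a fa by simp
    ultimately show ?thesis using add f' d by simp
  qed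
qed

section \<open>Frobenius reciprocity for compact induction\<close>

lemma rep_hom_cInd_eqI:
  assumes W: "group_rep C H W"
    and \<phi>: "\<phi> \<in> rep_hom C H (cInd H L U) W" and \<phi>': "\<phi>' \<in> rep_hom C H (cInd H L U) W"
    and eq: "\<And>u. u \<in> carrier U \<Longrightarrow> \<phi> (cInd_elem H L U u) = \<phi>' (cInd_elem H L U u)"
  shows "\<phi> = \<phi>'"
proof (rule PiE_ext[OF rep_homD(1)[OF \<phi>] rep_homD(1)[OF \<phi>']])
  fix f assume "f \<in> carrier (cInd H L U)"
  then show "\<phi> f = \<phi>' f"
  proof (induction rule: cInd_induct)
    case (elem g u)
    then show ?case
      using cInd_elem_closed[OF elem(2)] by (simp only: rep_homD(5)[OF \<phi>] rep_homD(5)[OF \<phi>'] eq)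
  next
    case (add f f')
    then show ?case by (simp only: rep_homD(3)[OF \<phi>] rep_homD(3)[OF \<phi>'])
  qed
qed

text \<open>A function is the sum of its restrictions to the cosets \<open>L a\<close>, which are the translates
  \<open>a\<inverse> [1, f a]\<close>; the values on these are forced.\<close>

lemma rep_hom_cInd_exists:
  assumes W: "group_rep C H W" and \<psi>: "\<psi> \<in> rep_hom C (subgrp H L) U W"
  obtains \<phi> where "\<phi> \<in> rep_hom C H (cInd H L U) W"
    and "\<And>u. u \<in> carrier U \<Longrightarrow> \<phi> (cInd_elem H L U u) = \<psi> u"
proof -
  interpret W: group_rep C H W by (rule W)
  interpret I: group_rep C H "cInd H L U" by (rule group_rep_cInd)
  interpret \<psi>: group_rep C "subgrp H L" W by (rule W.restrict[OF L.subgroup_axioms])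
  note psi = rep_homD(2-4)[OF \<psi>]
  have psi_act: "\<psi> (act U l u) = act W l (\<psi> u)" if "l \<in> L" "u \<in> carrier U" for l u
    using rep_homD(5)[OF \<psi>] that by simp
  have psi_zero: "\<psi> \<zero>\<^bsub>U\<^esub> = \<zero>\<^bsub>W\<^esub>"
    using rep_hom_zero[OF U.group_rep_axioms \<psi>.group_rep_axioms \<psi>] .
  \<comment> \<open>This is the forced contribution of the coset X: for a representative r, the
    element \<open>inv r\<close> applied to \<psi> (f r). The choice of r is harmless by the next
    fact.\<close>
  define t where "t f X = act W (inv\<^bsub>H\<^esub> (SOME r. r \<in> X)) (\<psi> (f (SOME r. r \<in> X)))" for f X
  have t: "t f (L #>\<^bsub>H\<^esub> a) = act W (inv\<^bsub>H\<^esub> a) (\<psi> (f a))"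
    if f: "f \<in> equivariant_funs H L U" and a: "a \<in> carrier H" for f a
  proof -
    define r where "r = (SOME r. r \<in> L #>\<^bsub>H\<^esub> a)"
    have "r \<in> L #>\<^bsub>H\<^esub> a"
      unfolding r_def using rcos_self[OF a] by (rule someI)
    then obtain l where l: "l \<in> L" "r = l \<otimes>\<^bsub>H\<^esub> a" using a by (rule in_rcosD)
    have fa: "\<psi> (f a) \<in> carrier W" "f a \<in> carrier U"
      using equivariant_funsD(2)[OF f a] psi by auto
    \<comment> \<open>Equivariance of f and \<psi> brings out a factor l, which cancels against the
      inverse of l contained in \<open>inv r\<close>.\<close>
    have "act W (inv\<^bsub>H\<^esub> r) (\<psi> (f r)) = act W (inv\<^bsub>H\<^esub> a \<otimes>\<^bsub>H\<^esub> inv\<^bsub>H\<^esub> l) (act W l (\<psi> (f a)))"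
      using l a fa equivariant_funsD(3)[OF f l(1) a] by (simp add: psi_act H.inv_mult_group)
    also have "\<dots> = act W (inv\<^bsub>H\<^esub> a) (\<psi> (f a))"
      using l a fa by (simp add: W.act_mult W.act_closed W.act_inv_act)
    finally show ?thesis by (simp add: t_def r_def)
  qed
  define R where "R = (\<lambda>a. L #>\<^bsub>H\<^esub> a) ` carrier H"
  have supp_R: "supp_cosets f \<subseteq> R" for f
    by (auto simp: supp_cosets_def R_def)
  have t_closed: "t f X \<in> carrier W" if "f \<in> equivariant_funs H L U" "X \<in> R" for f X
    using that t equivariant_funsD(2)[OF that(1)] psi by (auto simp: R_def W.act_closed)
  have t_zero: "t f X = \<zero>\<^bsub>W\<^esub>"
    if "f \<in> equivariant_funs H L U" "X \<in> R" "X \<notin> supp_cosets f" for f X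
    using that t in_supp_cosets_iff[OF that(1)] by (auto simp: R_def psi_zero)
  define \<phi> where "\<phi> = (\<lambda>f\<in>carrier (cInd H L U). \<Oplus>\<^bsub>W\<^esub>X\<in>supp_cosets f. t f X)"
  \<comment> \<open>Cosets outside the support contribute zero, so the sum may run over any larger
    finite set of cosets. For additivity this gives f, f' and their sum a common index set.\<close>
  have \<phi>: "\<phi> f = (\<Oplus>\<^bsub>W\<^esub>X\<in>S. t f X)"
    if "f \<in> carrier (cInd H L U)" "finite S" "supp_cosets f \<subseteq> S" "S \<subseteq> R" for f S
    using that t_closed t_zero unfolding \<phi>_def
    by (auto simp: carrier_cInd_iff subset_iff intro!: W.V.add.finprod_mono_neutral_cong_left)
  have "\<phi> \<in> rep_hom C H (cInd H L U) W"
  proof (rule rep_homI)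
    show "\<phi> \<in> carrier (cInd H L U) \<rightarrow>\<^sub>E carrier W"
      using t_closed supp_R
      by (auto simp: \<phi>_def carrier_cInd_iff intro!: W.V.finsum_closed dest: subsetD[OF supp_R])
  next
    fix f f' assume f: "f \<in> carrier (cInd H L U)" "f' \<in> carrier (cInd H L U)"
    let ?S = "supp_cosets f \<union> supp_cosets f'"
    have fe: "f \<in> equivariant_funs H L U" "f' \<in> equivariant_funs H L U" and S: "finite ?S" "?S \<subseteq> R"
      using f supp_R by (auto simp: carrier_cInd_iff)
    have sum: "f \<oplus>\<^bsub>cInd H L U\<^esub> f' \<in> carrier (cInd H L U)" using f by blast
    then have fe': "f \<oplus>\<^bsub>cInd H L U\<^esub> f' \<in> equivariant_funs H L U"
      unfolding carrier_cInd_iff by blast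
    have t_add: "t (f \<oplus>\<^bsub>cInd H L U\<^esub> f') X = t f X \<oplus>\<^bsub>W\<^esub> t f' X" if X: "X \<in> R" for X
    proof -
      obtain a where "a \<in> carrier H" "X = L #>\<^bsub>H\<^esub> a" using X by (auto simp: R_def)
      then show ?thesis
        using fe equivariant_funsD(2)[OF fe(1)] equivariant_funsD(2)[OF fe(2)]
        by (simp add: t t[OF fe'[simplified]] psi W.act_add)
    qed
    have "\<phi> (f \<oplus>\<^bsub>cInd H L U\<^esub> f') = (\<Oplus>\<^bsub>W\<^esub>X\<in>?S. t (f \<oplus>\<^bsub>cInd H L U\<^esub> f') X)"
      using S supp_cosets_add[of f f'] by (intro \<phi>[OF sum]) auto
    also have "\<dots> = (\<Oplus>\<^bsub>W\<^esub>X\<in>?S. t f X \<oplus>\<^bsub>W\<^esub> t f' X)"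
      using S(2) fe t_closed t_add by (intro W.V.finsum_cong') (auto simp: subset_iff)
    also have "\<dots> = (\<Oplus>\<^bsub>W\<^esub>X\<in>?S. t f X) \<oplus>\<^bsub>W\<^esub> (\<Oplus>\<^bsub>W\<^esub>X\<in>?S. t f' X)"
      using S(2) fe t_closed by (intro W.V.finsum_addf) (auto simp: subset_iff)
    also have "\<dots> = \<phi> f \<oplus>\<^bsub>W\<^esub> \<phi> f'"
      using f S by (simp add: \<phi>[of f ?S] \<phi>[of f' ?S])
    finally show "\<phi> (f \<oplus>\<^bsub>cInd H L U\<^esub> f') = \<phi> f \<oplus>\<^bsub>W\<^esub> \<phi> f'" .
  next
    fix c f assume c: "c \<in> carrier C" and f: "f \<in> carrier (cInd H L U)"
    let ?S = "supp_cosets f"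
    have fe: "f \<in> equivariant_funs H L U" and S: "finite ?S" "?S \<subseteq> R"
      using f supp_R by (auto simp: carrier_cInd_iff)
    have cf: "c \<odot>\<^bsub>cInd H L U\<^esub> f \<in> carrier (cInd H L U)" using c f by blast
    then have fe': "c \<odot>\<^bsub>cInd H L U\<^esub> f \<in> equivariant_funs H L U"
      unfolding carrier_cInd_iff by blast
    have t_smult: "t (c \<odot>\<^bsub>cInd H L U\<^esub> f) X = c \<odot>\<^bsub>W\<^esub> t f X" if X: "X \<in> R" for X
    proof -
      obtain a where "a \<in> carrier H" "X = L #>\<^bsub>H\<^esub> a" using X by (auto simp: R_def)
      then show ?thesis
        using fe c equivariant_funsD(2)[OF fe]
        by (simp add: t t[OF fe'[simplified]] psi W.act_smult)
    qed
    have "\<phi> (c \<odot>\<^bsub>cInd H L U\<^esub> f) = (\<Oplus>\<^bsub>W\<^esub>X\<in>?S. t (c \<odot>\<^bsub>cInd H L U\<^esub> f) X)"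
      using S supp_cosets_smult[OF c, of f] by (intro \<phi>[OF cf]) auto
    also have "\<dots> = (\<Oplus>\<^bsub>W\<^esub>X\<in>?S. c \<odot>\<^bsub>W\<^esub> t f X)"
      using S(2) fe c t_closed t_smult by (intro W.V.finsum_cong') (auto simp: subset_iff)
    also have "\<dots> = c \<odot>\<^bsub>W\<^esub> (\<Oplus>\<^bsub>W\<^esub>X\<in>?S. t f X)"
      using S fe c t_closed by (intro W.V.finsum_smult_ldistr[symmetric]) (auto simp: subset_iff)
    also have "\<dots> = c \<odot>\<^bsub>W\<^esub> \<phi> f"
      using f S by (simp add: \<phi>[of f ?S])
    finally show "\<phi> (c \<odot>\<^bsub>cInd H L U\<^esub> f) = c \<odot>\<^bsub>W\<^esub> \<phi> f" .
  next
    fix h f assume h: "h \<in> carrier H" and f: "f \<in> carrier (cInd H L U)"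
    let ?S = "supp_cosets f" and ?f = "act (cInd H L U) h f" and ?r = "\<lambda>X. X #>\<^bsub>H\<^esub> inv\<^bsub>H\<^esub> h"
    have fe: "f \<in> equivariant_funs H L U" and S: "finite ?S" "?S \<subseteq> R"
      using f supp_R by (auto simp: carrier_cInd_iff)
    have hf: "?f \<in> carrier (cInd H L U)" using h f by (rule I.act_closed)
    then have fe': "?f \<in> equivariant_funs H L U"
      unfolding carrier_cInd_iff by blast
    have r: "?r (L #>\<^bsub>H\<^esub> a) = L #>\<^bsub>H\<^esub> (a \<otimes>\<^bsub>H\<^esub> inv\<^bsub>H\<^esub> h)" if "a \<in> carrier H" for a
      using that h by (simp add: H.coset_mult_assoc[OF L.subset])
    then have r_R: "?r X \<in> R" if "X \<in> R" for X
      using that h by (auto simp: R_def)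
    \<comment> \<open>Translation of cosets by h undoes translation by its inverse; injectivity is
      needed to reindex the sum over the translated support.\<close>
    have inj: "inj_on ?r R"
      by (rule inj_on_inverseI[of _ "\<lambda>X. X #>\<^bsub>H\<^esub> h"])
        (use h in \<open>auto simp: R_def r H.coset_mult_assoc[OF L.subset] H.m_assoc\<close>)
    have t_act: "t ?f (?r X) = act W h (t f X)" if X: "X \<in> R" for X
    proof -
      obtain a where a: "a \<in> carrier H" "X = L #>\<^bsub>H\<^esub> a" using X by (auto simp: R_def)
      have fa: "\<psi> (f a) \<in> carrier W" using equivariant_funsD(2)[OF fe a(1)] psi by blast
      have "t ?f (?r X) = act W (inv\<^bsub>H\<^esub> (a \<otimes>\<^bsub>H\<^esub> inv\<^bsub>H\<^esub> h)) (\<psi> (?f (a \<otimes>\<^bsub>H\<^esub> inv\<^bsub>H\<^esub> h)))"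
        using a h by (simp only: r t[OF fe'] H.m_closed H.inv_closed)
      also have "\<dots> = act W (h \<otimes>\<^bsub>H\<^esub> inv\<^bsub>H\<^esub> a) (\<psi> (f a))"
        using a h by (simp add: H.inv_mult_group H.m_assoc)
      also have "\<dots> = act W h (t f X)"
        using a h fa by (simp add: t[OF fe] W.act_mult)
      finally show ?thesis .
    qed
    have "\<phi> ?f = (\<Oplus>\<^bsub>W\<^esub>X\<in>?r ` ?S. t ?f X)"
      using S h r_R supp_cosets_act[OF h, of f] by (intro \<phi>[OF hf]) auto
    also have "\<dots> = (\<Oplus>\<^bsub>W\<^esub>X\<in>?S. t ?f (?r X))"
      using S(2) fe' t_closed r_R inj inj_on_subset[OF inj S(2)]
      by (intro W.V.finsum_reindex) (auto simp: subset_iff)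
    also have "\<dots> = (\<Oplus>\<^bsub>W\<^esub>X\<in>?S. act W h (t f X))"
      using S(2) fe h t_closed t_act by (intro W.V.finsum_cong') (auto simp: subset_iff W.act_closed)
    also have "\<dots> = act W h (\<Oplus>\<^bsub>W\<^esub>X\<in>?S. t f X)"
      using S fe h t_closed by (intro W.act_finsum[symmetric]) (auto simp: subset_iff)
    also have "\<dots> = act W h (\<phi> f)"
      using f S by (simp add: \<phi>[of f ?S])
    finally show "\<phi> ?f = act W h (\<phi> f)" .
  qed
  moreover have "\<phi> (cInd_elem H L U u) = \<psi> u" if u: "u \<in> carrier U" for u
  proof -
    have L: "L = L #>\<^bsub>H\<^esub> \<one>\<^bsub>H\<^esub>" using H.coset_mult_one[OF L.subset] by simp
    have e: "cInd_elem H L U u \<in> equivariant_funs H L U"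
      using cInd_elem_closed[OF u] by (simp add: carrier_cInd_iff)
    have L_R: "L \<in> R" using L by (auto simp: R_def)
    \<comment> \<open>The support of [1, u] is empty when u is zero, hence the sum is taken over the
      larger set consisting of L alone.\<close>
    then have "\<phi> (cInd_elem H L U u) = (\<Oplus>\<^bsub>W\<^esub>X\<in>{L}. t (cInd_elem H L U u) X)"
      using supp_cosets_cInd_elem[of u] by (intro \<phi>[OF cInd_elem_closed[OF u]]) auto
    also have "\<dots> = t (cInd_elem H L U u) L"
      using t_closed[OF e L_R] by simp
    also have "\<dots> = \<psi> u"
      using t[OF e H.one_closed] u psi by (simp add: cInd_elem_apply act_U_one W.act_one flip: L)
    finally show ?thesis .
  qed
  ultimately show thesis by (rule that)
qed

end

section \<open>Smooth induction\<close>

lemma (in group) mult_inv_cancel: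
  assumes "x \<in> carrier G" "y \<in> carrier G"
  shows "x \<otimes> (inv x \<otimes> y) = y" "inv x \<otimes> (x \<otimes> y) = y"
  using assms by (simp_all flip: m_assoc)

context topological_group
begin

lemma carrier_if_openin: "\<lbrakk>openin T S; x \<in> S\<rbrakk> \<Longrightarrow> x \<in> carrier G"
  using openin_subset topspace_eq by blast

text \<open>Two-sided translation is continuous, and this is the preimage of S under it. It is
  applied with y equal to one, to move a neighbourhood of one to another point, and with x inverse
  to y, to conjugate one.\<close>

lemma openin_translate:
  assumes "x \<in> carrier G" "y \<in> carrier G" "openin T S"
  shows "openin T {g \<in> carrier G. x \<otimes> g \<otimes> y \<in> S}"
proof -
  have l: "continuous_map T T (\<lambda>g. x \<otimes> g)"
    using continuous_map_compose[OF _ continuous_mult, of T "\<lambda>g. (x, g)"] assms(1)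
    by (simp add: continuous_map_pairedI topspace_eq o_def)
  have r: "continuous_map T T (\<lambda>g. g \<otimes> y)"
    using continuous_map_compose[OF _ continuous_mult, of T "\<lambda>g. (g, y)"] assms(2)
    by (simp add: continuous_map_pairedI topspace_eq o_def)
  have "continuous_map T T (\<lambda>g. x \<otimes> g \<otimes> y)"
    using continuous_map_compose[OF l r] by (simp add: o_def)
  then show ?thesis
    using openin_continuous_map_preimage assms(3) by (fastforce simp: topspace_eq)
qed

text \<open>If the stabilizer of v contains a neighbourhood S of one, then around each of its
  elements h it contains the translate of S by h, and so it is open. This replaces openness of the
  stabilizer by a condition that is easy to verify.\<close>

lemma smooth_vector_iff:
  assumes "group_rep C G V" "v \<in> carrier V"
  shows "smooth_vector G T V v \<longleftrightarrow> (\<exists>S. openin T S \<and> \<one> \<in> S \<and> (\<forall>h\<in>S. act V h v = v))"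
proof -
  interpret V: group_rep C G V by fact
  show ?thesis
  proof
    assume "\<exists>S. openin T S \<and> \<one> \<in> S \<and> (\<forall>h\<in>S. act V h v = v)"
    then obtain S where S: "openin T S" "\<one> \<in> S" "\<And>h. h \<in> S \<Longrightarrow> act V h v = v" by blast
    have "\<exists>S'. openin T S' \<and> h \<in> S' \<and> S' \<subseteq> {h \<in> carrier G. act V h v = v}"
      if h: "h \<in> carrier G" "act V h v = v" for h
    proof (intro exI conjI)
      show "openin T {g \<in> carrier G. inv h \<otimes> g \<otimes> \<one> \<in> S}"
        using h S by (intro openin_translate) auto
      show "h \<in> {g \<in> carrier G. inv h \<otimes> g \<otimes> \<one> \<in> S}"
        using h S by simp
      show "{g \<in> carrier G. inv h \<otimes> g \<otimes> \<one> \<in> S} \<subseteq> {h \<in> carrier G. act V h v = v}"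
      proof safe
        fix g assume g: "g \<in> carrier G" "inv h \<otimes> g \<otimes> \<one> \<in> S"
        have "act V g v = act V h (act V (inv h \<otimes> g) v)"
          using g h assms(2) by (simp flip: V.act_mult m_assoc)
        then show "act V g v = v" using g h S by simp
      qed
    qed
    then show "smooth_vector G T V v"
      unfolding smooth_vector_def by (subst openin_subopen) blast
  next
    assume "smooth_vector G T V v"
    then show "\<exists>S. openin T S \<and> \<one> \<in> S \<and> (\<forall>h\<in>S. act V h v = v)"
      using assms(2) unfolding smooth_vector_def by (auto intro!: exI simp: V.act_one)
  qed
qed

end

context subgroup_rep
begin

text \<open>Smoothness in \<open>Ind\<close> refers to the translation action on equivariant
  functions. These are extensional, so being fixed by a translation is the same as invariance at
  every point of H.\<close>

lemma carrier_Ind_iff: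
  assumes "topological_group H T"
  shows "f \<in> carrier (Ind H T L U) \<longleftrightarrow> f \<in> equivariant_funs H L U \<and>
    (\<exists>S. openin T S \<and> \<one>\<^bsub>H\<^esub> \<in> S \<and> (\<forall>h\<in>S. \<forall>g\<in>carrier H. f (g \<otimes>\<^bsub>H\<^esub> h) = f g))"
proof -
  interpret T: topological_group H T by fact
  have "(\<lambda>g\<in>carrier H. f (g \<otimes>\<^bsub>H\<^esub> h)) = f \<longleftrightarrow> (\<forall>g\<in>carrier H. f (g \<otimes>\<^bsub>H\<^esub> h) = f g)"
    if "f \<in> equivariant_funs H L U" for h
  proof -
    have "f \<in> extensional (carrier H)"
      using equivariant_funsD(1)[OF that] by (simp add: PiE_iff)
    then show ?thesis
      using extensionalityI[of "\<lambda>g\<in>carrier H. f (g \<otimes>\<^bsub>H\<^esub> h)" "carrier H" f]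
      by (auto dest: fun_cong split: if_splits)
  qed
  then show ?thesis
    using T.smooth_vector_iff[OF group_rep_equivariant_funs, of f] by (auto simp: Ind_def)
qed

lemma group_rep_Ind:
  assumes T: "topological_group H T"
  shows "group_rep C H (Ind H T L U)"
proof -
  interpret T: topological_group H T by fact
  let ?S = "carrier (Ind H T L U)"
  have "group_rep C H (fun_rep H U ?S)"
  proof (rule group_rep_fun_rep[OF H.is_group U.V.module_axioms])
    show "?S \<subseteq> carrier H \<rightarrow>\<^sub>E carrier U"
      using equivariant_funsD(1) by (meson carrier_Ind_iff[OF T] subsetI)
    show "(\<lambda>g\<in>carrier H. \<zero>\<^bsub>U\<^esub>) \<in> ?S"
      using T.carrier_if_openin[of "carrier H"] openin_topspace[of T]
      by (auto simp: carrier_Ind_iff[OF T] equivariant_funs_closed T.topspace_eq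
          intro!: exI[of _ "carrier H"])
    show "(\<lambda>g\<in>carrier H. f g \<oplus>\<^bsub>U\<^esub> f' g) \<in> ?S" if f: "f \<in> ?S" "f' \<in> ?S" for f f'
    proof -
      obtain R R' where R: "openin T R" "\<one>\<^bsub>H\<^esub> \<in> R"
          "\<And>h g. \<lbrakk>h \<in> R; g \<in> carrier H\<rbrakk> \<Longrightarrow> f (g \<otimes>\<^bsub>H\<^esub> h) = f g"
        and R': "openin T R'" "\<one>\<^bsub>H\<^esub> \<in> R'"
          "\<And>h g. \<lbrakk>h \<in> R'; g \<in> carrier H\<rbrakk> \<Longrightarrow> f' (g \<otimes>\<^bsub>H\<^esub> h) = f' g"
        using f unfolding carrier_Ind_iff[OF T] by blast
      then show ?thesis
        using f T.carrier_if_openin[OF R(1)]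
        by (auto simp: carrier_Ind_iff[OF T] equivariant_funs_closed intro!: exI[of _ "R \<inter> R'"])
    qed
    show "(\<lambda>g\<in>carrier H. c \<odot>\<^bsub>U\<^esub> f g) \<in> ?S" if c: "c \<in> carrier C" and f: "f \<in> ?S" for c f
    proof -
      obtain R where R: "openin T R" "\<one>\<^bsub>H\<^esub> \<in> R"
          "\<And>h g. \<lbrakk>h \<in> R; g \<in> carrier H\<rbrakk> \<Longrightarrow> f (g \<otimes>\<^bsub>H\<^esub> h) = f g"
        using f unfolding carrier_Ind_iff[OF T] by blast
      then show ?thesis
        using c f T.carrier_if_openin[OF R(1)]
        by (auto simp: carrier_Ind_iff[OF T] equivariant_funs_closed intro!: exI[of _ R])
    qed
    show "(\<lambda>g\<in>carrier H. f (g \<otimes>\<^bsub>H\<^esub> x)) \<in> ?S" if x: "x \<in> carrier H" and f: "f \<in> ?S" for x f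
    proof -
      obtain R where R: "openin T R" "\<one>\<^bsub>H\<^esub> \<in> R"
          "\<And>h g. \<lbrakk>h \<in> R; g \<in> carrier H\<rbrakk> \<Longrightarrow> f (g \<otimes>\<^bsub>H\<^esub> h) = f g"
        using f unfolding carrier_Ind_iff[OF T] by blast
      \<comment> \<open>The translate by x is invariant under a conjugated neighbourhood, because g
        h x = (g x) (\<open>inv x\<close> h x).\<close>
      let ?R = "{h \<in> carrier H. inv\<^bsub>H\<^esub> x \<otimes>\<^bsub>H\<^esub> h \<otimes>\<^bsub>H\<^esub> x \<in> R}"
      have "openin T ?R" "\<one>\<^bsub>H\<^esub> \<in> ?R"
        using x R by (auto intro: T.openin_translate)
      moreover have "f (g \<otimes>\<^bsub>H\<^esub> h \<otimes>\<^bsub>H\<^esub> x) = f (g \<otimes>\<^bsub>H\<^esub> x)" if "h \<in> ?R" "g \<in> carrier H" for h g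
      proof -
        have "g \<otimes>\<^bsub>H\<^esub> h \<otimes>\<^bsub>H\<^esub> x = g \<otimes>\<^bsub>H\<^esub> x \<otimes>\<^bsub>H\<^esub> (inv\<^bsub>H\<^esub> x \<otimes>\<^bsub>H\<^esub> h \<otimes>\<^bsub>H\<^esub> x)"
          using that x by (simp add: H.m_assoc H.mult_inv_cancel)
        then show ?thesis using that x R(3) by simp
      qed
      ultimately show ?thesis
        using x f by (auto simp: carrier_Ind_iff[OF T] equivariant_funs_closed intro!: exI[of _ ?R])
    qed
  qed
  then show ?thesis by (simp add: Ind_def)
qed

end

section \<open>Inflation\<close>

text \<open>It is used twice: for P with factors N and M, and for P \<inter> K with factors N
  \<inter> K and M \<inter> K.\<close>

locale semidirect_decomposition = group G for G (structure) +
  fixes P N M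
  assumes semidirect: "semidirect G P N M"
begin

lemma subgroups: "subgroup P G" "subgroup N G" "subgroup M G" "N \<subseteq> P" "M \<subseteq> P"
proof -
  show P: "subgroup P G" using semidirect by (simp add: semidirect_def)
  have N: "subgroup N (subgrp G P)" and M: "subgroup M (subgrp G P)"
    using semidirect by (auto simp: semidirect_def normal_imp_subgroup)
  show "subgroup N G" "subgroup M G" using incl_subgroup[OF P] N M by blast+
  show "N \<subseteq> P" "M \<subseteq> P" using subgroup.subset[OF N] subgroup.subset[OF M] by auto
qed

lemma in_carrier: "p \<in> P \<Longrightarrow> p \<in> carrier G" "n \<in> N \<Longrightarrow> n \<in> carrier G" "m \<in> M \<Longrightarrow> m \<in> carrier G"
  using subgroups(1-3)[THEN subgroup.mem_carrier] by auto

lemma decompose: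
  assumes "p \<in> P"
  obtains n m where "n \<in> N" "m \<in> M" "p = n \<otimes> m"
proof -
  have "p \<in> N <#> M" using assms semidirect by (simp add: semidirect_def)
  then show thesis by (auto simp: set_mult_def intro: that)
qed

lemma conj_closed:
  assumes "p \<in> P" "n \<in> N"
  shows "p \<otimes> n \<otimes> inv p \<in> N"
proof -
  have "N \<lhd> subgrp G P" using semidirect by (simp add: semidirect_def)
  from normal.inv_op_closed2[OF this, of p n] assms show ?thesis
    by (simp add: subgroups)
qed

text \<open>Uniqueness in the \<open>THE\<close>: from n m = n' m' the element \<open>inv n'\<close>
  n equals m' \<open>inv m\<close>, hence lies in both N and M and is one.\<close>

lemma Levi_part_mult:
  assumes "n \<in> N" "m \<in> M"
  shows "Levi_part G N M (n \<otimes> m) = m"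
  unfolding Levi_part_def
proof (rule the_equality)
  show "m \<in> M \<and> (\<exists>n'\<in>N. n \<otimes> m = n' \<otimes> m)" using assms by blast
next
  fix m' assume m': "m' \<in> M \<and> (\<exists>n'\<in>N. n \<otimes> m = n' \<otimes> m')"
  then obtain n' where n': "n' \<in> N" "n \<otimes> m = n' \<otimes> m'" by blast
  have "inv n' \<otimes> n = inv n' \<otimes> (n \<otimes> m) \<otimes> inv m"
    using n'(1) assms in_carrier by (simp add: m_assoc)
  also have "\<dots> = m' \<otimes> inv m"
    using n' m' assms in_carrier by (simp flip: m_assoc)
  finally have "inv n' \<otimes> n = m' \<otimes> inv m" .
  moreover have "inv n' \<otimes> n \<in> N" "m' \<otimes> inv m \<in> M"
    using n' m' assms subgroups by (auto intro: subgroup.m_closed subgroup.m_inv_closed)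
  moreover have "N \<inter> M = {\<one>}" using semidirect by (simp add: semidirect_def)
  ultimately have "m' \<otimes> inv m = \<one>" by auto
  then have "m' \<otimes> inv m \<otimes> m = m"
    using assms in_carrier by simp
  then show "m' = m"
    using m' assms in_carrier by (simp add: m_assoc)
qed

lemma Levi_part_M: "m \<in> M \<Longrightarrow> Levi_part G N M m = m"
  using Levi_part_mult[of \<one> m] subgroup.one_closed[OF subgroups(2)] in_carrier by simp

lemma Levi_part_N: "n \<in> N \<Longrightarrow> Levi_part G N M n = \<one>"
  using Levi_part_mult[of n \<one>] subgroup.one_closed[OF subgroups(3)] in_carrier by simp

lemma Levi_part_closed: "p \<in> P \<Longrightarrow> Levi_part G N M p \<in> M"
  using Levi_part_mult by (auto elim: decompose)

text \<open>Normality of N allows n m n' m' to be regrouped as n (m n' \<open>inv m\<close>) times m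
  m'. This is what makes inflation an action of P.\<close>

lemma Levi_part_hom:
  assumes p: "p \<in> P" and q: "q \<in> P"
  shows "Levi_part G N M (p \<otimes> q) = Levi_part G N M p \<otimes> Levi_part G N M q"
proof -
  obtain n m where nm: "n \<in> N" "m \<in> M" "p = n \<otimes> m" using p by (rule decompose)
  obtain n' m' where nm': "n' \<in> N" "m' \<in> M" "q = n' \<otimes> m'" using q by (rule decompose)
  have "p \<otimes> q = (n \<otimes> (m \<otimes> n' \<otimes> inv m)) \<otimes> (m \<otimes> m')"
    using nm nm' in_carrier by (simp add: m_assoc mult_inv_cancel)
  moreover have "n \<otimes> (m \<otimes> n' \<otimes> inv m) \<in> N"
    using nm nm' subgroups conj_closed[of m n'] by (auto intro: subgroup.m_closed)
  moreover have "m \<otimes> m' \<in> M"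
    using nm nm' subgroups by (auto intro: subgroup.m_closed)
  ultimately show ?thesis using nm nm' by (simp add: Levi_part_mult)
qed

lemma inflation_simps [simp]:
  "carrier (inflation G N M W) = carrier W"
  "\<zero>\<^bsub>inflation G N M W\<^esub> = \<zero>\<^bsub>W\<^esub>"
  "w \<oplus>\<^bsub>inflation G N M W\<^esub> w' = w \<oplus>\<^bsub>W\<^esub> w'"
  "c \<odot>\<^bsub>inflation G N M W\<^esub> w = c \<odot>\<^bsub>W\<^esub> w"
  "act (inflation G N M W) p = act W (Levi_part G N M p)"
  by (simp_all add: inflation_def)

lemma subgroup_rep_inflation:
  assumes "group_rep C (subgrp G M) W"
  shows "subgroup_rep C G P (inflation G N M W)"
proof -
  interpret W: group_rep C "subgrp G M" W by fact
  let ?I = "inflation G N M W"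
  have "\<exists>y\<in>carrier W. y \<oplus>\<^bsub>W\<^esub> x = \<zero>\<^bsub>W\<^esub>" if "x \<in> carrier W" for x
    using that W.V.l_neg W.V.a_inv_closed by blast
  then have "abelian_group ?I"
    by (intro abelian_groupI) (simp_all add: W.V.a_ac)
  then have mod: "module C ?I"
    by (intro moduleI[OF W.V.is_cring])
      (simp_all add: W.V.smult_l_distr W.V.smult_r_distr W.V.smult_assoc1)
  have one: "Levi_part G N M \<one> = \<one>"
    using Levi_part_M subgroup.one_closed[OF subgroups(3)] by simp
  have "group_rep C (subgrp G P) ?I"
    using W.act_closed W.act_add W.act_smult W.act_one W.act_mult
    by (intro group_rep.intro group_rep_axioms.intro mod subgroup_imp_group[OF subgroups(1)])
      (simp_all add: Levi_part_closed Levi_part_hom one)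
  then show ?thesis
    by (intro subgroup_rep.intro is_group subgroups(1))
qed

end


section \<open>Coinvariants\<close>

context group_rep
begin

lemma coinv_generator:
  assumes "n \<in> L" "v \<in> carrier V"
  shows "act V n v \<ominus>\<^bsub>V\<^esub> v \<in> coinv_kernel C L V"
  unfolding coinv_kernel_def using assms by (intro hull_inc) blast

lemma coinv_kernel_minimal:
  assumes "submodule S C V" "\<And>n v. \<lbrakk>n \<in> L; v \<in> carrier V\<rbrakk> \<Longrightarrow> act V n v \<ominus>\<^bsub>V\<^esub> v \<in> S"
  shows "coinv_kernel C L V \<subseteq> S"
  unfolding coinv_kernel_def using assms by (intro hull_minimal) auto

lemma zero_in_submodule: "submodule S C V \<Longrightarrow> \<zero>\<^bsub>V\<^esub> \<in> S"
  using subgroup.one_closed[OF submodule.axioms(1), of S C V] by simp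

text \<open>The kernel of the coinvariants is a hull, so it lies in such a preimage as soon as its
  generators do. This is used with the action of a group element for f, and with an invariant linear
  map for f and zero for S.\<close>

lemma submodule_vimage:
  assumes "group_rep C H' W" "f \<in> carrier V \<rightarrow> carrier W" "submodule S C W"
    and "\<And>v w. \<lbrakk>v \<in> carrier V; w \<in> carrier V\<rbrakk> \<Longrightarrow> f (v \<oplus>\<^bsub>V\<^esub> w) = f v \<oplus>\<^bsub>W\<^esub> f w"
    and smult: "\<And>c v. \<lbrakk>c \<in> carrier C; v \<in> carrier V\<rbrakk> \<Longrightarrow> f (c \<odot>\<^bsub>V\<^esub> v) = c \<odot>\<^bsub>W\<^esub> f v"
  shows "submodule {v \<in> carrier V. f v \<in> S} C V"
proof -
  interpret W: group_rep C H' W by fact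
  note S = W.V.submoduleE[OF assms(3)]
  have f: "f v \<in> carrier W" if "v \<in> carrier V" for v using that assms(2) by auto
  have "f \<zero>\<^bsub>V\<^esub> = \<zero>\<^bsub>W\<^esub>"
    using smult[of "\<zero>\<^bsub>C\<^esub>" "\<zero>\<^bsub>V\<^esub>"] f by simp
  moreover have "f (\<ominus>\<^bsub>V\<^esub> v) = \<ominus>\<^bsub>W\<^esub> f v" if "v \<in> carrier V" for v
    using that smult[of "\<ominus>\<^bsub>C\<^esub> \<one>\<^bsub>C\<^esub>" v] f by (simp add: V.smult_l_minus W.V.smult_l_minus)
  ultimately show ?thesis
    using assms S W.zero_in_submodule by (intro V.submoduleI) auto
qed

context
  fixes L assumes L: "L \<subseteq> carrier H"
begin

lemma submodule_coinv_kernel: "submodule (coinv_kernel C L V) C V"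
proof -
  let ?gens = "{act V n v \<ominus>\<^bsub>V\<^esub> v | n v. n \<in> L \<and> v \<in> carrier V}"
  have gens: "?gens \<subseteq> carrier V"
    using L by (auto intro!: V.minus_closed act_closed)
  have "submodule (carrier V) C V" by (rule V.carrier_is_submodule)
  with gens have sub: "coinv_kernel C L V \<subseteq> carrier V"
    unfolding coinv_kernel_def by (rule hull_minimal)
  show ?thesis
    by (rule V.submoduleI[OF sub])
      (auto simp: coinv_kernel_def hull_def zero_in_submodule V.submoduleE)
qed

interpretation ker: abelian_subgroup "coinv_kernel C L V" V
  by (intro abelian_subgroupI3 additive_subgroup.intro V.abelian_group_axioms
      submodule.axioms(1)[OF submodule_coinv_kernel])

lemma mem_coinv_class:
  assumes "v \<in> carrier V"
  shows "w \<in> coinv_class C L V v \<longleftrightarrow> w \<in> carrier V \<and> coinv_class C L V w = coinv_class C L V v"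
  unfolding coinv_class_def
proof
  assume "w \<in> coinv_kernel C L V +>\<^bsub>V\<^esub> v"
  then show "w \<in> carrier V \<and> coinv_kernel C L V +>\<^bsub>V\<^esub> w = coinv_kernel C L V +>\<^bsub>V\<^esub> v"
    using assms ker.a_elemrcos_carrier ker.a_repr_independence' by metis
next
  assume "w \<in> carrier V \<and> coinv_kernel C L V +>\<^bsub>V\<^esub> w = coinv_kernel C L V +>\<^bsub>V\<^esub> v"
  then show "w \<in> coinv_kernel C L V +>\<^bsub>V\<^esub> v"
    using ker.a_rcos_self by metis
qed

lemma coinv_class_eq_iff:
  assumes "v \<in> carrier V" "w \<in> carrier V"
  shows "coinv_class C L V v = coinv_class C L V w \<longleftrightarrow> v \<ominus>\<^bsub>V\<^esub> w \<in> coinv_kernel C L V"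
proof -
  have "coinv_class C L V v = coinv_class C L V w \<longleftrightarrow> v \<in> coinv_class C L V w"
    using mem_coinv_class assms by blast
  then show ?thesis
    using ker.a_rcos_module[OF assms(2,1)] by (simp add: coinv_class_def V.minus_eq)
qed

section \<open>The quotient structure on the coinvariants\<close>

lemma carrier_coinv: "carrier (coinv C L V) = coinv_class C L V ` carrier V"
  by (auto simp: coinv_def coinv_class_def A_RCOSETS_def')

lemma coinv_add:
  assumes "v \<in> carrier V" "w \<in> carrier V"
  shows "coinv_class C L V (v \<oplus>\<^bsub>V\<^esub> w) = coinv_class C L V v \<oplus>\<^bsub>coinv C L V\<^esub> coinv_class C L V w"
  using ker.a_rcos_sum assms by (simp add: coinv_def coinv_class_def)

lemma coinv_zero: "coinv_class C L V \<zero>\<^bsub>V\<^esub> = \<zero>\<^bsub>coinv C L V\<^esub>"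
  using ker.a_rcos_const[of "\<zero>\<^bsub>V\<^esub>"] by (simp add: coinv_def coinv_class_def)

text \<open>Scalars and group elements act on a class by a union over all its members. A linear map
  that preserves the kernel sends all members to the same class, so the union is that one
  class.\<close>

lemma UN_coinv_class:
  assumes "f \<in> carrier V \<rightarrow> carrier V"
    and "\<And>v w. \<lbrakk>v \<in> carrier V; w \<in> carrier V\<rbrakk> \<Longrightarrow> f (v \<oplus>\<^bsub>V\<^esub> w) = f v \<oplus>\<^bsub>V\<^esub> f w"
    and smult: "\<And>c v. \<lbrakk>c \<in> carrier C; v \<in> carrier V\<rbrakk> \<Longrightarrow> f (c \<odot>\<^bsub>V\<^esub> v) = c \<odot>\<^bsub>V\<^esub> f v"
    and ker: "\<And>v. v \<in> coinv_kernel C L V \<Longrightarrow> f v \<in> coinv_kernel C L V"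
    and v: "v \<in> carrier V"
  shows "(\<Union>w\<in>coinv_class C L V v. coinv_class C L V (f w)) = coinv_class C L V (f v)"
proof -
  have "f (\<ominus>\<^bsub>V\<^esub> w) = \<ominus>\<^bsub>V\<^esub> f w" if "w \<in> carrier V" for w
    using that smult[of "\<ominus>\<^bsub>C\<^esub> \<one>\<^bsub>C\<^esub>" w] funcset_mem[OF assms(1) that]
    by (simp add: V.smult_l_minus)
  then have "f w \<ominus>\<^bsub>V\<^esub> f v \<in> coinv_kernel C L V"
    if "w \<in> carrier V" "w \<ominus>\<^bsub>V\<^esub> v \<in> coinv_kernel C L V" for w
    using ker[OF that(2)] that(1) v assms(2) by (simp add: V.minus_eq)
  then have "coinv_class C L V (f w) = coinv_class C L V (f v)" if "w \<in> coinv_class C L V v" for w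
    using that v funcset_mem[OF assms(1)] mem_coinv_class[OF v] coinv_class_eq_iff by metis
  moreover have "v \<in> coinv_class C L V v" using mem_coinv_class v by blast
  ultimately show ?thesis by blast
qed

lemma coinv_smult:
  assumes "c \<in> carrier C" "v \<in> carrier V"
  shows "coinv_class C L V (c \<odot>\<^bsub>V\<^esub> v) = c \<odot>\<^bsub>coinv C L V\<^esub> coinv_class C L V v"
proof -
  have "c \<odot>\<^bsub>V\<^esub> (d \<odot>\<^bsub>V\<^esub> w) = d \<odot>\<^bsub>V\<^esub> (c \<odot>\<^bsub>V\<^esub> w)" if "d \<in> carrier C" "w \<in> carrier V" for d w
    using that assms(1) by (metis V.smult_assoc1 V.m_comm)
  then show ?thesis
    using UN_coinv_class[of "\<lambda>w. c \<odot>\<^bsub>V\<^esub> w" v] assms V.submoduleE(4)[OF submodule_coinv_kernel]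
    by (simp add: coinv_def V.smult_r_distr)
qed

text \<open>The kernel is stable under h because h (n w - w) = n' (h w) - h w, where n' is the
  conjugate of n by h and lies in L again: generators go to generators.\<close>

lemma coinv_act:
  assumes h: "h \<in> carrier H" and conj: "\<And>n. n \<in> L \<Longrightarrow> h \<otimes>\<^bsub>H\<^esub> n \<otimes>\<^bsub>H\<^esub> inv\<^bsub>H\<^esub> h \<in> L"
    and v: "v \<in> carrier V"
  shows "coinv_class C L V (act V h v) = act (coinv C L V) h (coinv_class C L V v)"
proof -
  let ?K = "coinv_kernel C L V"
  have act_minus: "act V h (\<ominus>\<^bsub>V\<^esub> w) = \<ominus>\<^bsub>V\<^esub> act V h w" if "w \<in> carrier V" for w
    using that h act_smult[of h "\<ominus>\<^bsub>C\<^esub> \<one>\<^bsub>C\<^esub>" w] by (simp add: V.smult_l_minus act_closed)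
  have "?K \<subseteq> {w \<in> carrier V. act V h w \<in> ?K}"
  proof (rule coinv_kernel_minimal)
    show "submodule {w \<in> carrier V. act V h w \<in> ?K} C V"
      using h by (intro submodule_vimage[OF group_rep_axioms _ submodule_coinv_kernel])
        (auto simp: act_closed act_add act_smult)
  next
    fix n w assume n: "n \<in> L" and w: "w \<in> carrier V"
    then have nH: "n \<in> carrier H" using L by blast
    have "act V h (act V n w) = act V (h \<otimes>\<^bsub>H\<^esub> n \<otimes>\<^bsub>H\<^esub> inv\<^bsub>H\<^esub> h \<otimes>\<^bsub>H\<^esub> h) w"
      using h nH w by (simp add: act_mult H.m_assoc)
    also have "\<dots> = act V (h \<otimes>\<^bsub>H\<^esub> n \<otimes>\<^bsub>H\<^esub> inv\<^bsub>H\<^esub> h) (act V h w)"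
      using h nH w by (intro act_mult) auto
    finally have "act V h (act V n w \<ominus>\<^bsub>V\<^esub> w) =
        act V (h \<otimes>\<^bsub>H\<^esub> n \<otimes>\<^bsub>H\<^esub> inv\<^bsub>H\<^esub> h) (act V h w) \<ominus>\<^bsub>V\<^esub> act V h w"
      using h nH w by (simp add: V.minus_eq act_add act_closed act_minus)
    then show "act V n w \<ominus>\<^bsub>V\<^esub> w \<in> {w \<in> carrier V. act V h w \<in> ?K}"
      using h nH w coinv_generator[OF conj[OF n] act_closed[OF h w]] by (simp add: act_closed)
  qed
  then show ?thesis
    using UN_coinv_class[of "act V h" v] h v by (auto simp: coinv_def act_closed act_add act_smult)
qed

lemma group_rep_coinv:
  assumes Q: "subgroup Q H"
    and conj: "\<And>q n. \<lbrakk>q \<in> Q; n \<in> L\<rbrakk> \<Longrightarrow> q \<otimes>\<^bsub>H\<^esub> n \<otimes>\<^bsub>H\<^esub> inv\<^bsub>H\<^esub> q \<in> L"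
  shows "group_rep C (subgrp H Q) (coinv C L V)"
proof (rule group_rep_image[where q = "coinv_class C L V"])
  show "group_rep C (subgrp H Q) V" using Q by (rule restrict)
qed (use subgroup.mem_carrier[OF Q] conj in
    \<open>simp_all add: carrier_coinv coinv_add coinv_zero coinv_smult coinv_act\<close>)

text \<open>The universal property of coinvariants, stated for values: a linear map invariant under
  L kills the generators of the kernel, hence the kernel, hence it depends only on classes.\<close>

lemma coinv_class_cong:
  assumes W: "group_rep C H' W" and f: "f \<in> carrier V \<rightarrow> carrier W"
    and add: "\<And>v w. \<lbrakk>v \<in> carrier V; w \<in> carrier V\<rbrakk> \<Longrightarrow> f (v \<oplus>\<^bsub>V\<^esub> w) = f v \<oplus>\<^bsub>W\<^esub> f w"
    and smult: "\<And>c v. \<lbrakk>c \<in> carrier C; v \<in> carrier V\<rbrakk> \<Longrightarrow> f (c \<odot>\<^bsub>V\<^esub> v) = c \<odot>\<^bsub>W\<^esub> f v"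
    and inv: "\<And>n v. \<lbrakk>n \<in> L; v \<in> carrier V\<rbrakk> \<Longrightarrow> f (act V n v) = f v"
    and v: "v \<in> carrier V" "w \<in> carrier V" "coinv_class C L V v = coinv_class C L V w"
  shows "f v = f w"
proof -
  interpret W: group_rep C H' W by fact
  have fV: "f v \<in> carrier W" if "v \<in> carrier V" for v using that f by auto
  have f_minus: "f (v \<ominus>\<^bsub>V\<^esub> w) = f v \<ominus>\<^bsub>W\<^esub> f w" if "v \<in> carrier V" "w \<in> carrier V" for v w
    using that smult[of "\<ominus>\<^bsub>C\<^esub> \<one>\<^bsub>C\<^esub>" w] fV
    by (simp add: V.minus_eq W.V.minus_eq add V.smult_l_minus W.V.smult_l_minus)
  have "submodule {\<zero>\<^bsub>W\<^esub>} C W"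
    by (rule W.V.submoduleI) auto
  then have "submodule {v \<in> carrier V. f v \<in> {\<zero>\<^bsub>W\<^esub>}} C V"
    using W f add smult by (intro submodule_vimage)
  then have "coinv_kernel C L V \<subseteq> {v \<in> carrier V. f v \<in> {\<zero>\<^bsub>W\<^esub>}}"
    using L by (intro coinv_kernel_minimal)
      (auto simp: f_minus inv fV act_closed W.V.minus_eq W.V.r_neg subset_iff)
  moreover have "v \<ominus>\<^bsub>V\<^esub> w \<in> coinv_kernel C L V"
    using v coinv_class_eq_iff by blast
  ultimately have "f v \<ominus>\<^bsub>W\<^esub> f w = \<zero>\<^bsub>W\<^esub>" using v f_minus by auto
  moreover have "f v = (f v \<ominus>\<^bsub>W\<^esub> f w) \<oplus>\<^bsub>W\<^esub> f w"
    using v fV by (simp add: W.V.minus_eq W.V.a_assoc W.V.l_neg)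
  ultimately show ?thesis using v fV by simp
qed

end

end

section \<open>The Satake homomorphism\<close>

lemma IndP_simps [simp]:
  "\<zero>\<^bsub>IndP G T P N M W\<^esub> = (\<lambda>g\<in>carrier G. \<zero>\<^bsub>W\<^esub>)"
  "f \<oplus>\<^bsub>IndP G T P N M W\<^esub> f' = (\<lambda>g\<in>carrier G. f g \<oplus>\<^bsub>W\<^esub> f' g)"
  "c \<odot>\<^bsub>IndP G T P N M W\<^esub> f = (\<lambda>g\<in>carrier G. c \<odot>\<^bsub>W\<^esub> f g)"
  "act (IndP G T P N M W) x f = (\<lambda>g\<in>carrier G. f (g \<otimes>\<^bsub>G\<^esub> x))"
  by (simp_all add: IndP_def Ind_def inflation_def)

context iwasawa_setting
begin

sublocale G: locally_profinite_group G T
  by (rule locally_profinite)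

sublocale PNM: semidirect_decomposition G P N M
  by (intro semidirect_decomposition.intro semidirect_decomposition_axioms.intro
      G.group_axioms P_semidirect)

sublocale PK: semidirect_decomposition G "P \<inter> K" "N \<inter> K" "M \<inter> K"
  by (intro semidirect_decomposition.intro semidirect_decomposition_axioms.intro
      G.group_axioms PK_semidirect)

sublocale V: group_rep C "subgrp G K" V
  using V_smooth by (rule smooth_rep.axioms)

sublocale K_ind: subgroup_rep C G K V
  by (intro subgroup_rep.intro G.group_axioms K_subgroup V.group_rep_axioms)

abbreviation "cInd_KG \<equiv> cInd G K V"
abbreviation "cInd_KM \<equiv> cIndM C G K N M V"
abbreviation "Ind_P \<equiv> IndP G T P N M"
abbreviation "genG v \<equiv> cInd_elem G K V v"
abbreviation "V_N \<equiv> coinv C (N \<inter> K) V"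
abbreviation "bar v \<equiv> coinv_class C (N \<inter> K) V v"
abbreviation "genM v \<equiv> cInd_elem (subgrp G M) (M \<inter> K) V_N (bar v)"
abbreviation "j W \<equiv> frob_j C G K N M V W"
abbreviation "I\<^sub>0 \<equiv> I0 C G T K P N M V"
abbreviation "S' \<equiv> satake C G T K P N M V"

lemma in_K: "k \<in> K \<Longrightarrow> k \<in> carrier G"
  by (rule K_ind.L.mem_carrier)

lemma NK: "N \<inter> K \<subseteq> carrier (subgrp G K)"
  by simp

lemma conj_NK:
  assumes "m \<in> M \<inter> K" "n \<in> N \<inter> K"
  shows "m \<otimes>\<^bsub>subgrp G K\<^esub> n \<otimes>\<^bsub>subgrp G K\<^esub> inv\<^bsub>subgrp G K\<^esub> m \<in> N \<inter> K"
  using PK.conj_closed[of m n] assms PK.subgroups(5) by (auto simp: K_subgroup)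

lemma bar_act:
  assumes "v \<in> carrier V"
  shows "n \<in> N \<inter> K \<Longrightarrow> bar (act V n v) = bar v"
    and "m \<in> M \<inter> K \<Longrightarrow> bar (act V m v) = act V_N m (bar v)"
proof -
  show "bar (act V n v) = bar v" if "n \<in> N \<inter> K"
    using that assms V.coinv_class_eq_iff[OF NK] V.coinv_generator V.act_closed by simp
  show "bar (act V m v) = act V_N m (bar v)" if "m \<in> M \<inter> K"
    using that assms by (intro V.coinv_act[OF NK] conj_NK) auto
qed

lemma subgroup_MK: "subgroup (M \<inter> K) (subgrp G K)" "subgroup (M \<inter> K) (subgrp G M)"
  using PK.subgroups(3) K_subgroup PNM.subgroups(3) G.subgroup_incl by auto

lemma group_M: "group (subgrp G M)"
  using PNM.subgroups(3) by (rule G.subgroup_imp_group)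

sublocale M_ind: subgroup_rep C "subgrp G M" "M \<inter> K" V_N
  using V.group_rep_coinv[OF NK subgroup_MK(1) conj_NK]
  by (intro subgroup_rep.intro group_M subgroup_MK(2)) simp

lemma bar_closed: "v \<in> carrier V \<Longrightarrow> bar v \<in> carrier V_N"
  by (simp add: V.carrier_coinv[OF NK])

lemma group_rep_cInd_KM: "group_rep C (subgrp G M) cInd_KM"
  unfolding cIndM_def by (rule M_ind.group_rep_cInd)

lemma genG_closed: "v \<in> carrier V \<Longrightarrow> genG v \<in> carrier cInd_KG"
  by (rule K_ind.cInd_elem_closed)

lemma genM_closed: "v \<in> carrier V \<Longrightarrow> genM v \<in> carrier cInd_KM"
  unfolding cIndM_def by (intro M_ind.cInd_elem_closed bar_closed)

text \<open>The Iwasawa decomposition is given as G = K P; taking inverses turns it around into the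
  order that fits functions equivariant under P on the left.\<close>

lemma PK_decompose:
  assumes "g \<in> carrier G"
  obtains p k where "p \<in> P" "k \<in> K" "g = p \<otimes>\<^bsub>G\<^esub> k"
proof -
  have "inv\<^bsub>G\<^esub> g \<in> K <#>\<^bsub>G\<^esub> P" using assms iwasawa by auto
  then obtain k p where kp: "k \<in> K" "p \<in> P" "inv\<^bsub>G\<^esub> g = k \<otimes>\<^bsub>G\<^esub> p"
    by (auto simp: set_mult_def)
  then have "g = inv\<^bsub>G\<^esub> p \<otimes>\<^bsub>G\<^esub> inv\<^bsub>G\<^esub> k"
    using assms in_K PNM.in_carrier by (metis G.inv_inv G.inv_mult_group)
  then show thesis
    using kp P_subgroup K_subgroup by (intro that) (auto intro: subgroup.m_inv_closed)
qed

lemma group_rep_IndP: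
  assumes "group_rep C (subgrp G M) W"
  shows "group_rep C G (Ind_P W)"
  unfolding IndP_def
  by (intro subgroup_rep.group_rep_Ind PNM.subgroup_rep_inflation assms G.topological_group_axioms)

lemma carrier_IndP_iff:
  assumes "group_rep C (subgrp G M) W"
  shows "f \<in> carrier (Ind_P W) \<longleftrightarrow> f \<in> carrier G \<rightarrow>\<^sub>E carrier W \<and>
    (\<forall>p\<in>P. \<forall>g\<in>carrier G. f (p \<otimes>\<^bsub>G\<^esub> g) = act W (Levi_part G N M p) (f g)) \<and>
    (\<exists>S. openin T S \<and> \<one>\<^bsub>G\<^esub> \<in> S \<and> (\<forall>h\<in>S. \<forall>g\<in>carrier G. f (g \<otimes>\<^bsub>G\<^esub> h) = f g))"
  unfolding IndP_def
    subgroup_rep.carrier_Ind_iff[OF PNM.subgroup_rep_inflation[OF assms] G.topological_group_axioms]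
  by (simp add: equivariant_funs_def)

lemma carrier_IndPD:
  assumes "group_rep C (subgrp G M) W" "f \<in> carrier (Ind_P W)"
  shows "f \<in> carrier G \<rightarrow>\<^sub>E carrier W"
    and "g \<in> carrier G \<Longrightarrow> f g \<in> carrier W"
    and "\<lbrakk>p \<in> P; g \<in> carrier G\<rbrakk> \<Longrightarrow> f (p \<otimes>\<^bsub>G\<^esub> g) = act W (Levi_part G N M p) (f g)"
  using assms(2) unfolding carrier_IndP_iff[OF assms(1)] by (auto simp: PiE_iff)

lemma IndP_map_hom:
  assumes W: "group_rep C (subgrp G M) W" and W': "group_rep C (subgrp G M) W'"
    and \<alpha>: "\<alpha> \<in> rep_hom C (subgrp G M) W W'"
  shows "IndP_map G T P N M W \<alpha> \<in> rep_hom C G (Ind_P W) (Ind_P W')"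
proof -
  interpret IW: group_rep C G "Ind_P W" using W by (rule group_rep_IndP)
  note a = rep_homD(2-5)[OF \<alpha>] and f = carrier_IndPD(2)[OF W]
  \<comment> \<open>A neighbourhood that leaves f invariant does the same for \<alpha> applied to f,
    and P acts on both sides through M, for which \<alpha> is linear.\<close>
  have closed: "(\<lambda>g\<in>carrier G. \<alpha> (f g)) \<in> carrier (Ind_P W')" if F: "f \<in> carrier (Ind_P W)" for f
  proof -
    obtain S where S: "openin T S" "\<one>\<^bsub>G\<^esub> \<in> S"
        "\<And>h g. \<lbrakk>h \<in> S; g \<in> carrier G\<rbrakk> \<Longrightarrow> f (g \<otimes>\<^bsub>G\<^esub> h) = f g"
      using F unfolding carrier_IndP_iff[OF W] by blast
    then show ?thesis
      using G.carrier_if_openin[OF S(1)] PNM.in_carrier PNM.Levi_part_closed carrier_IndPD[OF W F]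
      by (auto simp: carrier_IndP_iff[OF W'] a intro!: exI[of _ S])
  qed
  show ?thesis
    unfolding IndP_map_def
  proof (rule rep_homI)
    fix x f assume "x \<in> carrier G" "f \<in> carrier (Ind_P W)"
    then show "(\<lambda>f\<in>carrier (Ind_P W). \<lambda>g\<in>carrier G. \<alpha> (f g)) (act (Ind_P W) x f) =
        act (Ind_P W') x ((\<lambda>f\<in>carrier (Ind_P W). \<lambda>g\<in>carrier G. \<alpha> (f g)) f)"
      using IW.act_closed[of x f] by auto
  next
    fix c f assume "c \<in> carrier C" "f \<in> carrier (Ind_P W)"
    then show "(\<lambda>f\<in>carrier (Ind_P W). \<lambda>g\<in>carrier G. \<alpha> (f g)) (c \<odot>\<^bsub>Ind_P W\<^esub> f) =
        c \<odot>\<^bsub>Ind_P W'\<^esub> (\<lambda>f\<in>carrier (Ind_P W). \<lambda>g\<in>carrier G. \<alpha> (f g)) f"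
      using IW.V.smult_closed[of c f] by (auto simp: a f)
  next
    fix f f' assume "f \<in> carrier (Ind_P W)" "f' \<in> carrier (Ind_P W)"
    then show "(\<lambda>f\<in>carrier (Ind_P W). \<lambda>g\<in>carrier G. \<alpha> (f g)) (f \<oplus>\<^bsub>Ind_P W\<^esub> f') =
        (\<lambda>f\<in>carrier (Ind_P W). \<lambda>g\<in>carrier G. \<alpha> (f g)) f \<oplus>\<^bsub>Ind_P W'\<^esub>
        (\<lambda>f\<in>carrier (Ind_P W). \<lambda>g\<in>carrier G. \<alpha> (f g)) f'"
      using IW.V.a_closed[of f f'] by (auto simp: a f)
  qed (simp add: closed)
qed

section \<open>Homomorphisms into Ind_P and their values at one\<close>

lemma hom_genG_apply:
  assumes W: "group_rep C (subgrp G M) W" and I: "I \<in> rep_hom C G cInd_KG (Ind_P W)"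
    and "p \<in> P" "k \<in> K" "v \<in> carrier V"
  shows "I (genG v) (p \<otimes>\<^bsub>G\<^esub> k) = act W (Levi_part G N M p) (I (genG (act V k v)) \<one>\<^bsub>G\<^esub>)"
proof -
  have "I (genG (act V k v)) = act (Ind_P W) k (I (genG v))"
    using K_ind.cInd_elem_act[OF assms(4,5)] rep_homD(5)[OF I in_K genG_closed] assms(4,5)
    by metis
  then have "I (genG (act V k v)) \<one>\<^bsub>G\<^esub> = I (genG v) k"
    using in_K assms by simp
  then show ?thesis
    using carrier_IndPD(3)[OF W rep_homD(2)[OF I genG_closed]] assms in_K by simp
qed

text \<open>In substance the injectivity of \<open>j\<close>, phrased with values at one so that it
  can be used before \<open>frob_j\<close> is under control.\<close>

lemma rep_hom_IndP_eqI:
  assumes W: "group_rep C (subgrp G M) W"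
    and I: "I \<in> rep_hom C G cInd_KG (Ind_P W)" and I': "I' \<in> rep_hom C G cInd_KG (Ind_P W)"
    and eq: "\<And>v. v \<in> carrier V \<Longrightarrow> I (genG v) \<one>\<^bsub>G\<^esub> = I' (genG v) \<one>\<^bsub>G\<^esub>"
  shows "I = I'"
proof (rule K_ind.rep_hom_cInd_eqI[OF group_rep_IndP[OF W] I I'])
  fix v assume v: "v \<in> carrier V"
  show "I (genG v) = I' (genG v)"
  proof (rule PiE_ext)
    show "I (genG v) \<in> carrier G \<rightarrow>\<^sub>E carrier W" "I' (genG v) \<in> carrier G \<rightarrow>\<^sub>E carrier W"
      using carrier_IndPD(1)[OF W] rep_homD(2)[OF I] rep_homD(2)[OF I'] genG_closed[OF v] by blast+
    fix g assume "g \<in> carrier G"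
    then obtain p k where pk: "p \<in> P" "k \<in> K" "g = p \<otimes>\<^bsub>G\<^esub> k" by (rule PK_decompose)
    then show "I (genG v) g = I' (genG v) g"
      using hom_genG_apply[OF W I pk(1,2) v] hom_genG_apply[OF W I' pk(1,2) v]
        eq[OF V.act_closed[of k v]] v by simp
  qed
qed

text \<open>The uniqueness half of the \<open>THE\<close> in \<open>frob_j\<close>: every
  coinvariant is the class of some v, so the functions \<open>genM v\<close> include all
  generators.\<close>

lemma rep_hom_cInd_KM_eqI:
  assumes "group_rep C (subgrp G M) W"
    and "\<phi> \<in> rep_hom C (subgrp G M) cInd_KM W" "\<phi>' \<in> rep_hom C (subgrp G M) cInd_KM W"
    and "\<And>v. v \<in> carrier V \<Longrightarrow> \<phi> (genM v) = \<phi>' (genM v)"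
  shows "\<phi> = \<phi>'"
  using assms(4) unfolding atomize_all
  by (intro M_ind.rep_hom_cInd_eqI[OF assms(1) assms(2,3)[unfolded cIndM_def]])
    (auto simp: V.carrier_coinv[OF NK])

lemma frob_j_exists:
  assumes W: "group_rep C (subgrp G M) W" and I: "I \<in> rep_hom C G cInd_KG (Ind_P W)"
  obtains \<phi> where "\<phi> \<in> rep_hom C (subgrp G M) cInd_KM W"
    and "\<And>v. v \<in> carrier V \<Longrightarrow> \<phi> (genM v) = I (genG v) \<one>\<^bsub>G\<^esub>"
proof -
  interpret W: group_rep C "subgrp G M" W by (rule W)
  define f where "f v = I (genG v) \<one>\<^bsub>G\<^esub>" for v
  note IX = rep_homD(2)[OF I genG_closed]
  have f_closed: "f v \<in> carrier W" if "v \<in> carrier V" for v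
    using carrier_IndPD(2)[OF W IX] that by (simp add: f_def)
  have f_add: "f (v \<oplus>\<^bsub>V\<^esub> w) = f v \<oplus>\<^bsub>W\<^esub> f w" if "v \<in> carrier V" "w \<in> carrier V" for v w
    unfolding f_def K_ind.cInd_elem_linear(1)[OF that]
      rep_homD(3)[OF I that[THEN genG_closed]] by simp
  have f_smult: "f (c \<odot>\<^bsub>V\<^esub> v) = c \<odot>\<^bsub>W\<^esub> f v" if "v \<in> carrier V" "c \<in> carrier C" for c v
    unfolding f_def K_ind.cInd_elem_linear(2)[OF that]
      rep_homD(4)[OF I that(2) genG_closed[OF that(1)]] by simp
  \<comment> \<open>The value of \<open>I (genG v)\<close> at x is computed in two ways: as one
    times x with x in K, and as x times one with x in P. Equating them gives equivariance under P
    \<inter> K, from which invariance under N \<inter> K and linearity for M \<inter> K both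
    follow.\<close>
  have f_act: "f (act V x v) = act W (Levi_part G N M x) (f v)"
    if "x \<in> P \<inter> K" "v \<in> carrier V" for x v
  proof -
    have one: "Levi_part G N M \<one>\<^bsub>G\<^esub> = \<one>\<^bsub>G\<^esub>"
      using PNM.Levi_part_M subgroup.one_closed[OF PNM.subgroups(3)] by simp
    have x: "x \<in> P" "x \<in> K" "x \<in> carrier G" using that in_K by auto
    have "f (act V x v) = I (genG v) (\<one>\<^bsub>G\<^esub> \<otimes>\<^bsub>G\<^esub> x)"
      using hom_genG_apply[OF W I subgroup.one_closed[OF P_subgroup] x(2) that(2)]
        W.act_one[of "f (act V x v)"] f_closed V.act_closed[of x v] that x
      by (simp add: one f_def)
    also have "\<dots> = I (genG v) (x \<otimes>\<^bsub>G\<^esub> \<one>\<^bsub>G\<^esub>)" using x by simp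
    also have "\<dots> = act W (Levi_part G N M x) (f v)"
      using hom_genG_apply[OF W I x(1) K_ind.L.one_closed that(2)] V.act_one[OF that(2)]
      by (simp add: f_def)
    finally show ?thesis .
  qed
  have f_N: "f (act V n v) = f v" if "n \<in> N \<inter> K" "v \<in> carrier V" for n v
    using f_act[of n v] that PK.subgroups(4) PNM.Levi_part_N[of n] W.act_one[of "f v"] f_closed
    by (auto simp: subset_iff)
  have f_bar: "f v = f w" if "v \<in> carrier V" "w \<in> carrier V" "bar v = bar w" for v w
    by (rule V.coinv_class_cong[where f = f, OF NK W _ f_add f_smult f_N that])
      (auto simp: f_closed)
  \<comment> \<open>The map induced by f on coinvariants, through a chosen representative of each
    class; \<open>f_bar\<close> makes the choice irrelevant.\<close>
  define \<psi> where "\<psi> = (\<lambda>X\<in>carrier V_N. f (SOME v. v \<in> carrier V \<and> bar v = X))"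
  have \<psi>: "\<psi> (bar v) = f v" if v: "v \<in> carrier V" for v
  proof -
    let ?w = "SOME w. w \<in> carrier V \<and> bar w = bar v"
    have "?w \<in> carrier V \<and> bar ?w = bar v"
      by (rule someI[of _ v]) (use v in simp)
    then have "f ?w = f v" using v by (intro f_bar) auto
    then show ?thesis using v bar_closed by (simp add: \<psi>_def)
  qed
  have ex: "\<exists>v\<in>carrier V. X = bar v" if "X \<in> carrier V_N" for X
    using that by (auto simp: V.carrier_coinv[OF NK])
  have "\<psi> \<in> rep_hom C (subgrp (subgrp G M) (M \<inter> K)) V_N W"
  proof (rule rep_homI)
    have "\<psi> \<in> extensional (carrier V_N)" by (simp add: \<psi>_def)
    then show "\<psi> \<in> carrier V_N \<rightarrow>\<^sub>E carrier W"
      by (auto dest!: ex simp: PiE_iff \<psi> f_closed)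
  next
    fix X Y assume "X \<in> carrier V_N" "Y \<in> carrier V_N"
    then show "\<psi> (X \<oplus>\<^bsub>V_N\<^esub> Y) = \<psi> X \<oplus>\<^bsub>W\<^esub> \<psi> Y"
      by (auto dest!: ex simp: \<psi> f_add simp flip: V.coinv_add[OF NK])
  next
    fix c X assume "c \<in> carrier C" "X \<in> carrier V_N"
    then show "\<psi> (c \<odot>\<^bsub>V_N\<^esub> X) = c \<odot>\<^bsub>W\<^esub> \<psi> X"
      by (auto dest!: ex simp: \<psi> f_smult simp flip: V.coinv_smult[OF NK])
  next
    fix m X assume m: "m \<in> carrier (subgrp (subgrp G M) (M \<inter> K))" and "X \<in> carrier V_N"
    then obtain v where v: "v \<in> carrier V" "X = bar v" using ex by blast
    have "f (act V m v) = act W m (f v)"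
      using f_act[of m v] m v PK.subgroups(5) PNM.Levi_part_M[of m] by (auto simp: subset_iff)
    then show "\<psi> (act V_N m X) = act W m (\<psi> X)"
      using m v V.act_closed[of m v] by (simp add: \<psi> flip: bar_act(2))
  qed
  then obtain \<phi> where \<phi>: "\<phi> \<in> rep_hom C (subgrp G M) cInd_KM W"
      and \<phi>_gen: "\<And>X. X \<in> carrier V_N \<Longrightarrow> \<phi> (cInd_elem (subgrp G M) (M \<inter> K) V_N X) = \<psi> X"
    unfolding cIndM_def by (rule M_ind.rep_hom_cInd_exists[OF W]) blast
  show thesis
  proof (rule that[OF \<phi>])
    fix v assume v: "v \<in> carrier V"
    show "\<phi> (genM v) = I (genG v) \<one>\<^bsub>G\<^esub>"
      using \<phi>_gen[OF bar_closed[OF v]] \<psi>[OF v] by (simp only: f_def)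
  qed
qed

text \<open>This is how \<open>j\<close> is computed throughout: a candidate is exhibited and its
  values on the generators \<open>genM v\<close> are compared.\<close>

lemma frob_j_eqI:
  assumes W: "group_rep C (subgrp G M) W" and \<phi>: "\<phi> \<in> rep_hom C (subgrp G M) cInd_KM W"
    and eq: "\<And>v. v \<in> carrier V \<Longrightarrow> \<phi> (genM v) = I (genG v) \<one>\<^bsub>G\<^esub>"
  shows "j W I = \<phi>"
  unfolding frob_j_def using \<phi> eq
  by (intro the_equality) (auto intro!: rep_hom_cInd_KM_eqI[OF W _ \<phi>])

lemma frob_j:
  assumes W: "group_rep C (subgrp G M) W" and I: "I \<in> rep_hom C G cInd_KG (Ind_P W)"
  shows "j W I \<in> rep_hom C (subgrp G M) cInd_KM W"
    and "v \<in> carrier V \<Longrightarrow> j W I (genM v) = I (genG v) \<one>\<^bsub>G\<^esub>"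
proof -
  obtain \<phi> where \<phi>: "\<phi> \<in> rep_hom C (subgrp G M) cInd_KM W"
      "\<And>v. v \<in> carrier V \<Longrightarrow> \<phi> (genM v) = I (genG v) \<one>\<^bsub>G\<^esub>"
    using frob_j_exists[OF W I] by blast
  then have "j W I = \<phi>" by (intro frob_j_eqI[OF W])
  then show "j W I \<in> rep_hom C (subgrp G M) cInd_KM W"
    "v \<in> carrier V \<Longrightarrow> j W I (genM v) = I (genG v) \<one>\<^bsub>G\<^esub>" using \<phi> by auto
qed

section \<open>Construction and characterization of I_0\<close>

lemma genM_act:
  assumes "v \<in> carrier V"
  shows "n \<in> N \<inter> K \<Longrightarrow> genM (act V n v) = genM v"
    and "m \<in> M \<inter> K \<Longrightarrow> genM (act V m v) = act cInd_KM m (genM v)"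
  using assms by (simp_all add: bar_act bar_closed M_ind.cInd_elem_act cIndM_def del: M_ind.cInd_simps)

text \<open>Two decompositions differ by x = \<open>inv p\<close> p' = k \<open>inv k'\<close> in P
  \<inter> K. Write x = n m. Then p' = p x has Levi part that of p times m, and k = n m k'. The
  factor m moves through [1, -], and n is absorbed by the coinvariants.\<close>

lemma genM_well_defined:
  assumes pk: "p \<in> P" "k \<in> K" "p' \<in> P" "k' \<in> K" "p \<otimes>\<^bsub>G\<^esub> k = p' \<otimes>\<^bsub>G\<^esub> k'"
    and v: "v \<in> carrier V"
  shows "act cInd_KM (Levi_part G N M p) (genM (act V k v)) =
    act cInd_KM (Levi_part G N M p') (genM (act V k' v))"
proof -
  interpret Y: group_rep C "subgrp G M" cInd_KM by (rule group_rep_cInd_KM)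
  note carr = pk(1,3)[THEN PNM.in_carrier(1)] pk(2,4)[THEN in_K]
  define x where "x = inv\<^bsub>G\<^esub> p \<otimes>\<^bsub>G\<^esub> p'"
  have x: "x = k \<otimes>\<^bsub>G\<^esub> inv\<^bsub>G\<^esub> k'"
  proof -
    have "x = inv\<^bsub>G\<^esub> p \<otimes>\<^bsub>G\<^esub> (p' \<otimes>\<^bsub>G\<^esub> k') \<otimes>\<^bsub>G\<^esub> inv\<^bsub>G\<^esub> k'"
      using carr by (simp add: x_def G.m_assoc)
    also have "\<dots> = k \<otimes>\<^bsub>G\<^esub> inv\<^bsub>G\<^esub> k'"
      using carr by (simp flip: pk(5) G.m_assoc)
    finally show ?thesis .
  qed
  have "x \<in> P"
    unfolding x_def using pk P_subgroup by (intro subgroup.m_closed subgroup.m_inv_closed)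
  moreover have "x \<in> K"
    unfolding x using pk K_subgroup by (intro subgroup.m_closed subgroup.m_inv_closed)
  ultimately obtain n m where nm: "n \<in> N \<inter> K" "m \<in> M \<inter> K" "x = n \<otimes>\<^bsub>G\<^esub> m"
    by (meson IntI PK.decompose)
  have p': "p' = p \<otimes>\<^bsub>G\<^esub> x"
    using carr by (simp add: x_def flip: G.m_assoc)
  have k: "k = n \<otimes>\<^bsub>G\<^esub> (m \<otimes>\<^bsub>G\<^esub> k')"
  proof -
    have "k = x \<otimes>\<^bsub>G\<^esub> k'" using carr by (simp add: x G.m_assoc)
    then show ?thesis using carr nm in_K by (simp add: G.m_assoc)
  qed
  have k'v: "act V k' v \<in> carrier V" using V.act_closed pk v by simp
  have mk'v: "act V m (act V k' v) \<in> carrier V" using V.act_closed k'v nm by simp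
  have "Levi_part G N M p' = Levi_part G N M p \<otimes>\<^bsub>G\<^esub> m"
    using p' pk \<open>x \<in> P\<close> nm by (simp add: PNM.Levi_part_hom PNM.Levi_part_mult)
  then have "act cInd_KM (Levi_part G N M p') (genM (act V k' v)) =
      act cInd_KM (Levi_part G N M p) (act cInd_KM m (genM (act V k' v)))"
    using Y.act_mult[of "Levi_part G N M p" m "genM (act V k' v)"] PNM.Levi_part_closed pk nm
      genM_closed[OF k'v] by simp
  also have "act cInd_KM m (genM (act V k' v)) = genM (act V m (act V k' v))"
    using genM_act(2)[OF k'v] nm by simp
  also have "\<dots> = genM (act V n (act V m (act V k' v)))"
    using genM_act(1)[OF mk'v] nm by simp
  also have "\<dots> = genM (act V k v)"
    using V.act_mult[of n "m \<otimes>\<^bsub>G\<^esub> k'" v] V.act_mult[of m k' v] nm pk v k by simp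
  finally show ?thesis by simp
qed

lemma I0_exists:
  obtains I where "I \<in> rep_hom C G cInd_KG (Ind_P cInd_KM)"
    and "\<And>v. v \<in> carrier V \<Longrightarrow> I (genG v) \<one>\<^bsub>G\<^esub> = genM v"
proof -
  interpret Y: group_rep C "subgrp G M" cInd_KM by (rule group_rep_cInd_KM)
  define F where "F v p k = act cInd_KM (Levi_part G N M p) (genM (act V k v))" for v p k
  \<comment> \<open>A decomposition g = p k is chosen, p by itself and k to match it. The next fact
    shows that any other decomposition gives the same value, so \<iota> v is the function sending p
    k to \<open>F v p k\<close>.\<close>
  define \<iota> where "\<iota> = (\<lambda>v\<in>carrier V. \<lambda>g\<in>carrier G.
    F v (SOME p. p \<in> P \<and> (\<exists>k\<in>K. g = p \<otimes>\<^bsub>G\<^esub> k))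
      (SOME k. k \<in> K \<and> g = (SOME p. p \<in> P \<and> (\<exists>k\<in>K. g = p \<otimes>\<^bsub>G\<^esub> k)) \<otimes>\<^bsub>G\<^esub> k))"
  have \<iota>: "\<iota> v (p \<otimes>\<^bsub>G\<^esub> k) = F v p k" if "p \<in> P" "k \<in> K" "v \<in> carrier V" for v p k
  proof -
    let ?p = "SOME p'. p' \<in> P \<and> (\<exists>k'\<in>K. p \<otimes>\<^bsub>G\<^esub> k = p' \<otimes>\<^bsub>G\<^esub> k')"
    let ?k = "SOME k'. k' \<in> K \<and> p \<otimes>\<^bsub>G\<^esub> k = ?p \<otimes>\<^bsub>G\<^esub> k'"
    have p: "?p \<in> P \<and> (\<exists>k'\<in>K. p \<otimes>\<^bsub>G\<^esub> k = ?p \<otimes>\<^bsub>G\<^esub> k')"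
      by (rule someI[of _ p]) (use that in blast)
    then have k: "?k \<in> K \<and> p \<otimes>\<^bsub>G\<^esub> k = ?p \<otimes>\<^bsub>G\<^esub> ?k"
      by (intro someI_ex[of "\<lambda>k'. k' \<in> K \<and> p \<otimes>\<^bsub>G\<^esub> k = ?p \<otimes>\<^bsub>G\<^esub> k'"]) blast
    have "F v ?p ?k = F v p k"
      unfolding F_def using p k that by (intro genM_well_defined) auto
    then show ?thesis
      using that in_K PNM.in_carrier by (simp add: \<iota>_def)
  qed
  have kv: "act V k v \<in> carrier V" if "k \<in> K" "v \<in> carrier V" for k v
    using V.act_closed that by simp
  have F_closed: "F v p k \<in> carrier cInd_KM" if "p \<in> P" "k \<in> K" "v \<in> carrier V" for v p k
    unfolding F_def using that by (intro Y.act_closed genM_closed kv) (auto simp: PNM.Levi_part_closed)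
  have \<iota>_closed: "\<iota> v \<in> carrier (Ind_P cInd_KM)" if v: "v \<in> carrier V" for v
    unfolding carrier_IndP_iff[OF group_rep_cInd_KM]
  proof (intro conjI ballI)
    have "\<iota> v g \<in> carrier cInd_KM" if "g \<in> carrier G" for g
      using that by (rule PK_decompose) (use v in \<open>simp add: \<iota> F_closed\<close>)
    moreover have "\<iota> v \<in> extensional (carrier G)" using v by (simp add: \<iota>_def)
    ultimately show "\<iota> v \<in> carrier G \<rightarrow>\<^sub>E carrier cInd_KM" by (simp add: PiE_iff)
  next
    fix q g assume q: "q \<in> P" and "g \<in> carrier G"
    then obtain p k where pk: "p \<in> P" "k \<in> K" "g = p \<otimes>\<^bsub>G\<^esub> k" by (meson PK_decompose)
    have qp: "q \<otimes>\<^bsub>G\<^esub> p \<in> P" using q pk P_subgroup by (intro subgroup.m_closed)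
    have "\<iota> v (q \<otimes>\<^bsub>G\<^esub> g) = \<iota> v (q \<otimes>\<^bsub>G\<^esub> p \<otimes>\<^bsub>G\<^esub> k)"
      using q pk in_K PNM.in_carrier by (simp add: G.m_assoc)
    also have "\<dots> = act cInd_KM (Levi_part G N M q) (F v p k)"
      using Y.act_mult[of "Levi_part G N M q" "Levi_part G N M p" "genM (act V k v)"]
        q pk v genM_closed[OF kv[OF pk(2) v]]
      by (simp add: \<iota>[OF qp pk(2) v] F_def PNM.Levi_part_hom PNM.Levi_part_closed)
    also have "F v p k = \<iota> v g" using pk v by (simp add: \<iota>)
    finally show "\<iota> v (q \<otimes>\<^bsub>G\<^esub> g) = act cInd_KM (Levi_part G N M q) (\<iota> v g)" .
  next
    \<comment> \<open>The stabilizer of v in K is open in K by smoothness of V, and open in G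
      because K is. Right translation by such an h replaces k v by k (h v) = k v.\<close>
    let ?S = "{h \<in> K. act V h v = v}"
    have "openin (subtopology T K) ?S"
      using smooth_rep.smooth[OF V_smooth v] by (simp add: smooth_vector_def)
    then have "openin T ?S" using K_open openin_open_subtopology by blast
    moreover have "\<one>\<^bsub>G\<^esub> \<in> ?S" using K_ind.L.one_closed K_ind.act_U_one v by simp
    moreover have "\<iota> v (g \<otimes>\<^bsub>G\<^esub> h) = \<iota> v g" if h: "h \<in> ?S" and g: "g \<in> carrier G" for h g
    proof -
      obtain p k where pk: "p \<in> P" "k \<in> K" "g = p \<otimes>\<^bsub>G\<^esub> k" using g by (rule PK_decompose)
      have kh: "k \<otimes>\<^bsub>G\<^esub> h \<in> K" using pk h by blast
      have "\<iota> v (g \<otimes>\<^bsub>G\<^esub> h) = \<iota> v (p \<otimes>\<^bsub>G\<^esub> (k \<otimes>\<^bsub>G\<^esub> h))"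
        using pk h in_K PNM.in_carrier by (simp add: G.m_assoc)
      also have "\<dots> = \<iota> v g"
        using \<iota>[OF pk(1) kh v] \<iota>[OF pk(1,2) v] pk h v by (simp add: F_def K_ind.act_U)
      finally show ?thesis .
    qed
    ultimately show "\<exists>S. openin T S \<and> \<one>\<^bsub>G\<^esub> \<in> S \<and>
        (\<forall>h\<in>S. \<forall>g\<in>carrier G. \<iota> v (g \<otimes>\<^bsub>G\<^esub> h) = \<iota> v g)" by blast
  qed
  \<comment> \<open>As G = P K, extensional functions may be compared on products p k, where the
    formula for \<iota> applies.\<close>
  have ext: "f = f'" if "f \<in> extensional (carrier G)" "f' \<in> extensional (carrier G)"
      "\<And>p k. \<lbrakk>p \<in> P; k \<in> K\<rbrakk> \<Longrightarrow> f (p \<otimes>\<^bsub>G\<^esub> k) = f' (p \<otimes>\<^bsub>G\<^esub> k)" for f f' :: "'g \<Rightarrow> 'g \<Rightarrow> 'v set"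
    using that by (intro extensionalityI[of f "carrier G" f']) (auto elim!: PK_decompose)
  have \<iota>_ext: "\<iota> v \<in> extensional (carrier G)" if "v \<in> carrier V" for v
    using that by (simp add: \<iota>_def)
  have pkG: "p \<otimes>\<^bsub>G\<^esub> k \<in> carrier G" if "p \<in> P" "k \<in> K" for p k
    using that in_K PNM.in_carrier by simp
  have genM_add: "genM (v \<oplus>\<^bsub>V\<^esub> w) = genM v \<oplus>\<^bsub>cInd_KM\<^esub> genM w"
    if "v \<in> carrier V" "w \<in> carrier V" for v w
    unfolding cIndM_def using that
    by (simp only: V.coinv_add[OF NK] M_ind.cInd_elem_linear bar_closed)
  have genM_smult: "genM (c \<odot>\<^bsub>V\<^esub> v) = c \<odot>\<^bsub>cInd_KM\<^esub> genM v"
    if "c \<in> carrier C" "v \<in> carrier V" for c v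
    unfolding cIndM_def using that
    by (simp only: V.coinv_smult[OF NK] M_ind.cInd_elem_linear bar_closed)
  have "\<iota> \<in> rep_hom C (subgrp G K) V (Ind_P cInd_KM)"
  proof (rule rep_homI)
    show "\<iota> \<in> carrier V \<rightarrow>\<^sub>E carrier (Ind_P cInd_KM)"
      using \<iota>_closed by (auto simp: PiE_iff \<iota>_def)
  next
    fix v w assume vw: "v \<in> carrier V" "w \<in> carrier V"
    show "\<iota> (v \<oplus>\<^bsub>V\<^esub> w) = \<iota> v \<oplus>\<^bsub>Ind_P cInd_KM\<^esub> \<iota> w"
    proof (rule ext)
      fix p k assume pk: "p \<in> P" "k \<in> K"
      then show "\<iota> (v \<oplus>\<^bsub>V\<^esub> w) (p \<otimes>\<^bsub>G\<^esub> k) = (\<iota> v \<oplus>\<^bsub>Ind_P cInd_KM\<^esub> \<iota> w) (p \<otimes>\<^bsub>G\<^esub> k)"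
        using vw by (simp add: \<iota> pkG F_def K_ind.act_U genM_add kv Y.act_add genM_closed
            PNM.Levi_part_closed)
    qed (use vw \<iota>_ext in auto)
  next
    fix c v assume cv: "c \<in> carrier C" "v \<in> carrier V"
    show "\<iota> (c \<odot>\<^bsub>V\<^esub> v) = c \<odot>\<^bsub>Ind_P cInd_KM\<^esub> \<iota> v"
    proof (rule ext)
      fix p k assume pk: "p \<in> P" "k \<in> K"
      then show "\<iota> (c \<odot>\<^bsub>V\<^esub> v) (p \<otimes>\<^bsub>G\<^esub> k) = (c \<odot>\<^bsub>Ind_P cInd_KM\<^esub> \<iota> v) (p \<otimes>\<^bsub>G\<^esub> k)"
        using cv by (simp add: \<iota> pkG F_def K_ind.act_U genM_smult kv Y.act_smult genM_closed
            PNM.Levi_part_closed)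
    qed (use cv \<iota>_ext in auto)
  next
    fix h v assume "h \<in> carrier (subgrp G K)" and v: "v \<in> carrier V"
    then have h: "h \<in> K" by simp
    show "\<iota> (act V h v) = act (Ind_P cInd_KM) h (\<iota> v)"
    proof (rule ext)
      fix p k assume pk: "p \<in> P" "k \<in> K"
      \<comment> \<open>Linearity of \<iota> for K: translating by h replaces k by k h, and (k h) v
        = k (h v).\<close>
      have kh: "k \<otimes>\<^bsub>G\<^esub> h \<in> K" using pk h by blast
      have "p \<otimes>\<^bsub>G\<^esub> k \<otimes>\<^bsub>G\<^esub> h = p \<otimes>\<^bsub>G\<^esub> (k \<otimes>\<^bsub>G\<^esub> h)"
        using pk h in_K PNM.in_carrier by (simp add: G.m_assoc)
      then show "\<iota> (act V h v) (p \<otimes>\<^bsub>G\<^esub> k) = act (Ind_P cInd_KM) h (\<iota> v) (p \<otimes>\<^bsub>G\<^esub> k)"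
        using pk h v kh by (simp add: \<iota> pkG F_def K_ind.act_U)
    qed (use h v kv \<iota>_ext in auto)
  qed
  then obtain I where I: "I \<in> rep_hom C G cInd_KG (Ind_P cInd_KM)"
      "\<And>v. v \<in> carrier V \<Longrightarrow> I (genG v) = \<iota> v"
    by (rule K_ind.rep_hom_cInd_exists[OF group_rep_IndP[OF group_rep_cInd_KM]]) blast
  have "\<iota> v \<one>\<^bsub>G\<^esub> = genM v" if v: "v \<in> carrier V" for v
  proof -
    have one: "Levi_part G N M \<one>\<^bsub>G\<^esub> = \<one>\<^bsub>G\<^esub>"
      using PNM.Levi_part_M subgroup.one_closed[OF PNM.subgroups(3)] by simp
    have "\<iota> v \<one>\<^bsub>G\<^esub> = \<iota> v (\<one>\<^bsub>G\<^esub> \<otimes>\<^bsub>G\<^esub> \<one>\<^bsub>G\<^esub>)" by simp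
    also have "\<dots> = F v \<one>\<^bsub>G\<^esub> \<one>\<^bsub>G\<^esub>"
      using subgroup.one_closed[OF P_subgroup] v by (intro \<iota>) auto
    also have "\<dots> = genM v"
      using v Y.act_one[OF genM_closed[OF v]] by (simp add: F_def one K_ind.act_U_one)
    finally show ?thesis .
  qed
  with I show thesis by (intro that) auto
qed

text \<open>The implicit description by \<open>j\<close> being the identity is traded for the value
  \<open>genM v\<close> at one. Conversely, any candidate with identity image under \<open>j\<close>
  has these values, so it agrees with the constructed one.\<close>

lemma I0:
  shows "I\<^sub>0 \<in> rep_hom C G cInd_KG (Ind_P cInd_KM)"
    and "v \<in> carrier V \<Longrightarrow> I\<^sub>0 (genG v) \<one>\<^bsub>G\<^esub> = genM v"
proof -
  let ?id = "\<lambda>\<phi>\<in>carrier cInd_KM. \<phi>"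
  note Y = group_rep_cInd_KM
  obtain I where I: "I \<in> rep_hom C G cInd_KG (Ind_P cInd_KM)"
      "\<And>v. v \<in> carrier V \<Longrightarrow> I (genG v) \<one>\<^bsub>G\<^esub> = genM v"
    using I0_exists by blast
  have "I\<^sub>0 = I"
    unfolding I0_def
  proof (rule the_equality)
    show "I \<in> rep_hom C G cInd_KG (Ind_P cInd_KM) \<and> j cInd_KM I = ?id"
      using I by (intro conjI frob_j_eqI[OF Y rep_hom_id[OF Y]]) (simp_all add: genM_closed)
  next
    fix I' assume I': "I' \<in> rep_hom C G cInd_KG (Ind_P cInd_KM) \<and> j cInd_KM I' = ?id"
    have "I' (genG v) \<one>\<^bsub>G\<^esub> = I (genG v) \<one>\<^bsub>G\<^esub>" if "v \<in> carrier V" for v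
      using frob_j(2)[OF Y, of I' v] I' I that by (simp add: genM_closed)
    then show "I' = I"
      using I' I(1) by (intro rep_hom_IndP_eqI[OF Y]) auto
  qed
  then show "I\<^sub>0 \<in> rep_hom C G cInd_KG (Ind_P cInd_KM)"
    "v \<in> carrier V \<Longrightarrow> I\<^sub>0 (genG v) \<one>\<^bsub>G\<^esub> = genM v" using I by auto
qed

section \<open>The three assertions, deduced from values at one\<close>

lemma IndP_map_I0:
  assumes W: "group_rep C (subgrp G M) W" and \<alpha>: "\<alpha> \<in> rep_hom C (subgrp G M) cInd_KM W"
  shows "compose (carrier cInd_KG) (IndP_map G T P N M cInd_KM \<alpha>) I\<^sub>0 \<in> rep_hom C G cInd_KG (Ind_P W)"
    and "f \<in> carrier cInd_KG \<Longrightarrow>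
      compose (carrier cInd_KG) (IndP_map G T P N M cInd_KM \<alpha>) I\<^sub>0 f \<one>\<^bsub>G\<^esub> = \<alpha> (I\<^sub>0 f \<one>\<^bsub>G\<^esub>)"
  using rep_hom_compose[OF K_ind.group_rep_cInd I0(1) IndP_map_hom[OF group_rep_cInd_KM W \<alpha>]]
    rep_homD(2)[OF I0(1)]
  by (simp_all add: compose_def IndP_map_def)

text \<open>Assertion (ii): the value on [1, v] at one is \<alpha> applied to \<open>genM v\<close>,
  which is the condition characterizing \<alpha> as the image under \<open>j\<close>.\<close>

lemma frob_j_IndP_map_I0:
  assumes W: "group_rep C (subgrp G M) W" and \<alpha>: "\<alpha> \<in> rep_hom C (subgrp G M) cInd_KM W"
  shows "j W (compose (carrier cInd_KG) (IndP_map G T P N M cInd_KM \<alpha>) I\<^sub>0) = \<alpha>"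
  by (rule frob_j_eqI[OF W \<alpha>]) (simp add: IndP_map_I0(2)[OF W \<alpha>] genG_closed I0(2))

text \<open>Generators show that I is I_0 followed by Ind_P of \<open>j W I\<close>; reading this
  identity on an arbitrary f extends the defining property of \<open>j\<close> beyond generators. It
  is applied to f = \<open>b (genG v)\<close>, which in general is not of the form [1, v].\<close>

lemma hom_eq_frob_j_I0:
  assumes W: "group_rep C (subgrp G M) W" and I: "I \<in> rep_hom C G cInd_KG (Ind_P W)"
    and f: "f \<in> carrier cInd_KG"
  shows "I f \<one>\<^bsub>G\<^esub> = j W I (I\<^sub>0 f \<one>\<^bsub>G\<^esub>)"
proof -
  note jI = frob_j[OF W I]
  have "compose (carrier cInd_KG) (IndP_map G T P N M cInd_KM (j W I)) I\<^sub>0 = I"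
    by (rule rep_hom_IndP_eqI[OF W IndP_map_I0(1)[OF W jI(1)] I])
      (simp add: IndP_map_I0(2)[OF W jI(1)] genG_closed I0(2) jI(2))
  then show ?thesis
    using IndP_map_I0(2)[OF W jI(1) f] by simp
qed

lemma satake:
  assumes "b \<in> rep_hom C G cInd_KG cInd_KG"
  shows "S' b \<in> rep_hom C (subgrp G M) cInd_KM cInd_KM"
    and "v \<in> carrier V \<Longrightarrow> S' b (genM v) = I\<^sub>0 (b (genG v)) \<one>\<^bsub>G\<^esub>"
  using frob_j[OF group_rep_cInd_KM rep_hom_compose[OF K_ind.group_rep_cInd assms I0(1)]]
  by (simp_all add: satake_def compose_def genG_closed)

lemma satake_eqI:
  assumes "\<phi> \<in> rep_hom C (subgrp G M) cInd_KM cInd_KM"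
    and "\<And>v. v \<in> carrier V \<Longrightarrow> \<phi> (genM v) = I\<^sub>0 (b (genG v)) \<one>\<^bsub>G\<^esub>"
  shows "S' b = \<phi>"
  unfolding satake_def using assms
  by (intro frob_j_eqI[OF group_rep_cInd_KM]) (simp_all add: compose_def genG_closed)

text \<open>Both sides give \<open>S' b (genM v)\<close> on [1, v] at one: on the left by the
  definition of S', on the right because I_0 has value \<open>genM v\<close> there.\<close>

lemma I0_compose:
  assumes b: "b \<in> rep_hom C G cInd_KG cInd_KG"
  shows "compose (carrier cInd_KG) I\<^sub>0 b =
    compose (carrier cInd_KG) (IndP_map G T P N M cInd_KM (S' b)) I\<^sub>0"
proof (rule rep_hom_IndP_eqI[OF group_rep_cInd_KM])
  show "compose (carrier cInd_KG) I\<^sub>0 b \<in> rep_hom C G cInd_KG (Ind_P cInd_KM)"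
    by (rule rep_hom_compose[OF K_ind.group_rep_cInd b I0(1)])
  show "compose (carrier cInd_KG) (IndP_map G T P N M cInd_KM (S' b)) I\<^sub>0
      \<in> rep_hom C G cInd_KG (Ind_P cInd_KM)"
    by (rule IndP_map_I0(1)[OF group_rep_cInd_KM satake(1)[OF b]])
next
  fix v assume v: "v \<in> carrier V"
  have "compose (carrier cInd_KG) I\<^sub>0 b (genG v) \<one>\<^bsub>G\<^esub> = S' b (genM v)"
    using v by (simp add: compose_eq genG_closed satake(2)[OF b])
  also have "\<dots> = compose (carrier cInd_KG) (IndP_map G T P N M cInd_KM (S' b)) I\<^sub>0 (genG v) \<one>\<^bsub>G\<^esub>"
    using v by (simp add: IndP_map_I0(2)[OF group_rep_cInd_KM satake(1)[OF b]] genG_closed I0(2))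
  finally show "compose (carrier cInd_KG) I\<^sub>0 b (genG v) \<one>\<^bsub>G\<^esub> =
    compose (carrier cInd_KG) (IndP_map G T P N M cInd_KM (S' b)) I\<^sub>0 (genG v) \<one>\<^bsub>G\<^esub>" .
qed

text \<open>Assertion (iii): I at \<open>b (genG v)\<close>, evaluated at one, is
  \<open>j W I\<close> of the value of I_0 there, and that value is
  \<open>S' b (genM v)\<close>.\<close>

lemma frob_j_compose:
  assumes W: "group_rep C (subgrp G M) W" and b: "b \<in> rep_hom C G cInd_KG cInd_KG"
    and I: "I \<in> rep_hom C G cInd_KG (Ind_P W)"
  shows "j W (compose (carrier cInd_KG) I b) = compose (carrier cInd_KM) (j W I) (S' b)"
proof (rule frob_j_eqI[OF W])
  show "compose (carrier cInd_KM) (j W I) (S' b) \<in> rep_hom C (subgrp G M) cInd_KM W"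
    by (rule rep_hom_compose[OF group_rep_cInd_KM satake(1)[OF b] frob_j(1)[OF W I]])
next
  fix v assume v: "v \<in> carrier V"
  then show "compose (carrier cInd_KM) (j W I) (S' b) (genM v) =
      compose (carrier cInd_KG) I b (genG v) \<one>\<^bsub>G\<^esub>"
    using hom_eq_frob_j_I0[OF W I rep_homD(2)[OF b genG_closed[OF v]]]
    by (simp add: compose_eq genG_closed genM_closed satake(2)[OF b])
qed

lemma algebra_hom_satake:
  "algebra_hom C (End_alg C G cInd_KG) (End_alg C (subgrp G M) cInd_KM) S'"
proof (intro algebra_hom.intro algebra_hom_axioms.intro ring_hom_memI)
  note X = K_ind.group_rep_cInd and Y = group_rep_cInd_KM
  note satake_simps = satake(2) I0(2) genG_closed genM_closed
  show "assoc_algebra C (End_alg C G cInd_KG)" "assoc_algebra C (End_alg C (subgrp G M) cInd_KM)"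
    using X Y by (auto intro: assoc_algebra_End_alg)
  show "S' b \<in> carrier (End_alg C (subgrp G M) cInd_KM)" if "b \<in> carrier (End_alg C G cInd_KG)" for b
    using that by (simp add: End_alg_simps satake(1))
  show "S' (b \<otimes>\<^bsub>End_alg C G cInd_KG\<^esub> b') = S' b \<otimes>\<^bsub>End_alg C (subgrp G M) cInd_KM\<^esub> S' b'"
    if "b \<in> carrier (End_alg C G cInd_KG)" "b' \<in> carrier (End_alg C G cInd_KG)" for b b'
  proof -
    have b: "b \<in> rep_hom C G cInd_KG cInd_KG" "b' \<in> rep_hom C G cInd_KG cInd_KG"
      using that by (simp_all add: End_alg_simps)
    \<comment> \<open>After reassociating, assertion (iii) for the homomorphism obtained by
      composing b with I_0 splits off the factor \<open>S' b'\<close>; what remains is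
      \<open>S' b\<close> by definition.\<close>
    have "compose (carrier cInd_KG) I\<^sub>0 (compose (carrier cInd_KG) b b') =
        compose (carrier cInd_KG) (compose (carrier cInd_KG) I\<^sub>0 b) b'"
      using rep_homD(2)[OF b(2)] by (auto simp: compose_def)
    then show ?thesis
      using frob_j_compose[OF Y b(2) rep_hom_compose[OF X b(1) I0(1)]]
      by (simp add: End_alg_simps satake_def)
  qed
  show "S' (b \<oplus>\<^bsub>End_alg C G cInd_KG\<^esub> b') = S' b \<oplus>\<^bsub>End_alg C (subgrp G M) cInd_KM\<^esub> S' b'"
    if "b \<in> carrier (End_alg C G cInd_KG)" "b' \<in> carrier (End_alg C G cInd_KG)" for b b'
  proof -
    have b: "b \<in> rep_hom C G cInd_KG cInd_KG" "b' \<in> rep_hom C G cInd_KG cInd_KG"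
      using that by (simp_all add: End_alg_simps)
    \<comment> \<open>Additivity of I_0 and pointwise addition in Ind_P give the value at one. The
      sum in c-Ind is kept folded so that additivity of I_0 can be applied to it.\<close>
    show ?thesis
      unfolding End_alg_simps
      using rep_hom_add[OF Y Y satake(1)[OF b(1)] satake(1)[OF b(2)]]
      by (rule satake_eqI)
        (simp add: satake_simps b rep_homD(3)[OF I0(1)] rep_homD(2)[OF b(1)] rep_homD(2)[OF b(2)]
          del: K_ind.cInd_simps)
  qed
  show "S' \<one>\<^bsub>End_alg C G cInd_KG\<^esub> = \<one>\<^bsub>End_alg C (subgrp G M) cInd_KM\<^esub>"
    unfolding End_alg_simps using rep_hom_id[OF Y]
    by (rule satake_eqI) (simp add: satake_simps)
  show "S' (c \<odot>\<^bsub>End_alg C G cInd_KG\<^esub> b) = c \<odot>\<^bsub>End_alg C (subgrp G M) cInd_KM\<^esub> S' b"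
    if "c \<in> carrier C" "b \<in> carrier (End_alg C G cInd_KG)" for c b
  proof -
    have b: "b \<in> rep_hom C G cInd_KG cInd_KG"
      using that by (simp add: End_alg_simps)
    show ?thesis
      unfolding End_alg_simps
      using rep_hom_smult[OF Y Y satake(1)[OF b] that(1)]
      by (rule satake_eqI)
        (simp add: satake_simps b that(1) rep_homD(4)[OF I0(1)] rep_homD(2)[OF b]
          del: K_ind.cInd_simps)
  qed
qed

end

theorem proposition2p1:
  fixes C :: "('c, 'k) ring_scheme" and G :: "('g, 'm) monoid_scheme" and T :: "'g topology"
    and K P N M :: "'g set" and V :: "('c, 'v, 'g) rep"
  assumes "iwasawa_setting C G T K P N M V"
  shows
    "(algebra_hom C (End_alg C G (cInd G K V)) (End_alg C (subgrp G M) (cIndM C G K N M V))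
       (satake C G T K P N M V) \<and>
     (\<forall>b \<in> rep_hom C G (cInd G K V) (cInd G K V).
       compose (carrier (cInd G K V)) (I0 C G T K P N M V) b =
       compose (carrier (cInd G K V))
         (IndP_map G T P N M (cIndM C G K N M V) (satake C G T K P N M V b))
         (I0 C G T K P N M V))) \<and>
     (\<forall>(W :: ('c, 'w, 'g) rep) \<alpha>.
       smooth_rep C (subgrp G M) W (subtopology T M) \<longrightarrow>
       \<alpha> \<in> rep_hom C (subgrp G M) (cIndM C G K N M V) W \<longrightarrow>
       frob_j C G K N M V W
         (compose (carrier (cInd G K V))
           (IndP_map G T P N M (cIndM C G K N M V) \<alpha>) (I0 C G T K P N M V)) = \<alpha>) \<and>
     (\<forall>(W :: ('c, 'w, 'g) rep) b I.
       smooth_rep C (subgrp G M) W (subtopology T M) \<longrightarrow>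
       b \<in> rep_hom C G (cInd G K V) (cInd G K V) \<longrightarrow>
       I \<in> rep_hom C G (cInd G K V) (IndP G T P N M W) \<longrightarrow>
       frob_j C G K N M V W (compose (carrier (cInd G K V)) I b) =
       compose (carrier (cIndM C G K N M V))
         (frob_j C G K N M V W I) (satake C G T K P N M V b))"
proof -
  interpret iwasawa_setting C G T K P N M V by fact
  show ?thesis
    using algebra_hom_satake I0_compose frob_j_IndP_map_I0 frob_j_compose
    by (auto simp: smooth_rep_def)
qed

end
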